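(* Fix $0<q<1$ and an integer $r\ge1$, and let $Q=1/q$. There is a constant $c_r(q)$ such that, as $n\to\infty$, \[ E^{(r)}_n=c_r(q)\,n+n\,\varpi_r(\log_Q n)+o(n), \] where $\varpi_r$ is a continuous periodic function of period $1$ (arising from the poles $z=1+2k\pi i/\log Q$, $k\ne0$), and $c_r(q)\to 2^{-r}$ as $q\to1^-$. In the permutation model (the limit $q\to1$), the expected position of the $r$th left-to-right maximum counted from the right in a uniformly random permutation of $\{1,\dots,n\}$ is $\dfrac{n}{2^r}+o(n)$.
   Context: Words $a_1\dots a_n$ have independent letters with $\mathbb P\{a_i=k\}=pq^{k-1}$, $k\ge1$, $p=1-q$. An index $i$ is a left-to-right maximum if $a_i>a_j$ for all $j<i$ (strict). Left-to-right maxima are counted from the right (the last one is the 1st, the previous one the 2nd, etc.). $E^{(r)}_n=\mathbb E[(P-1)\cdot\mathbf 1\{\text{at least } r \text{ left-to-right maxima}\}]$ where $P$ is the index of the $r$th left-to-right maximum counted from the right. For a permutation $\pi_1\dots\pi_n$, left-to-right maxima and the counting from the right are defined in the same way, and the expected position means $\mathbb E[P\cdot\mathbf 1\{\text{at least } r \text{ left-to-right maxima}\}]$. *)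

theory Defs
  imports "HOL-Analysis.Analysis" "HOL-Library.Landau_Symbols"
    "HOL-Combinatorics.Multiset_Permutations"
begin

definition ltr_max :: "nat list \<Rightarrow> nat set" where
  "ltr_max w = {i. i < length w \<and> (\<forall>j<i. w ! j < w ! i)}"

text \<open>0-based index of the r-th left-to-right maximum counted from the right
  (r = 1 is the last one); only meaningful when there are at least r of them.\<close>
definition rth_ltr_max_idx :: "nat \<Rightarrow> nat list \<Rightarrow> nat" where
  "rth_ltr_max_idx r w = rev (sorted_list_of_set (ltr_max w)) ! (r - 1)"

definition word_prob :: "real \<Rightarrow> nat list \<Rightarrow> real" where
  "word_prob q w = (\<Prod>k\<leftarrow>w. (1 - q) * q ^ (k - 1))"

text \<open>E_n^(r) = E[(P - 1) * 1{at least r left-to-right maxima}], where P is the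
  1-based position; P - 1 is the 0-based index.\<close>
definition E_geom :: "nat \<Rightarrow> real \<Rightarrow> nat \<Rightarrow> real" where
  "E_geom r q n = infsum (\<lambda>w. word_prob q w * real (rth_ltr_max_idx r w)
        * (if card (ltr_max w) \<ge> r then 1 else 0))
     {w. length w = n \<and> (\<forall>k\<in>set w. 1 \<le> k)}"

text \<open>Permutation model: E[P * 1{at least r left-to-right maxima}], P the 1-based
  position, for a uniformly random permutation of {1..n}.\<close>
definition E_perm :: "nat \<Rightarrow> nat \<Rightarrow> real" where
  "E_perm r n = (\<Sum>\<pi>\<in>permutations_of_set {1..n}.
        real (rth_ltr_max_idx r \<pi> + 1) * (if card (ltr_max \<pi>) \<ge> r then 1 else 0))
     / fact n"

end

theory Submission
  imports Defs
begin

text \<open>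
  Let \<open>S b\<close> be the probability that a geometric word of length \<open>b\<close> starts with the letter 1 and has
  exactly \<open>r\<close> left-to-right maxima. The letters \<open>> k\<close> of a word, diminished by \<open>k\<close>, again form a
  geometric word, whose length is binomial with parameter \<open>y = q ^ k\<close>; the first of \<open>b\<close> uniformly
  placed letters has mean index \<open>(n - b) / (b + 1)\<close>. Splitting the expectation according to the value
  \<open>k + 1\<close> of the \<open>r\<close>th maximum from the right therefore gives
  \<open>E\<^sub>n = (\<Sum>k. \<Sum>b. S b * (n choose (b + 1)) * y ^ b * (1 - y) ^ (n - b))\<close>.

  By Poisson approximation the \<open>k\<close>th term is close to \<open>n * h (n * q ^ k)\<close> with
  \<open>h x = exp (- x) * (\<Sum>b. S b * x ^ b / (b + 1)!)\<close>, and both are dominated by \<open>n * min x (1 / x)\<close> at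
  \<open>x = n * q ^ k\<close>. Hence \<open>E\<^sub>n / n\<close> is asymptotic to the periodisation of \<open>u \<mapsto> h (Q powr u)\<close> at
  \<open>u = log Q n\<close>, whose mean over a period is \<open>(\<Sum>b. S b / (b * (b + 1))) / ln Q\<close>. As \<open>q \<rightarrow> 1\<close>,
  \<open>S (b + 1) / (1 - q)\<close> tends to the probability that a random permutation of \<open>b\<close> elements has
  \<open>r - 1\<close> left-to-right maxima, and the resulting series telescopes to \<open>2 ^ - r\<close>.
\<close>

section \<open>Words with independent geometric letters\<close>

text \<open>The threshold \<open>k\<close> plays the role of the largest letter read so far, so the
  recursion can consume the first letter. Letters are at least 1, so threshold 0 yields every
  left-to-right maximum.\<close>

primrec records :: "nat \<Rightarrow> nat list \<Rightarrow> nat list" where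
  "records k [] = []"
| "records k (c # w) = (if k < c then 0 # map Suc (records c w) else map Suc (records k w))"

lemma set_records:
  "set (records k w) = {i. i < length w \<and> k < w ! i \<and> (\<forall>j<i. w ! j < w ! i)}"
proof (induction w arbitrary: k)
  case (Cons c w)
  have "i \<in> set (records k (c # w)) \<longleftrightarrow>
    i < length (c # w) \<and> k < (c # w) ! i \<and> (\<forall>j<i. (c # w) ! j < (c # w) ! i)" for i
  proof (cases i)
    case 0
    then show ?thesis by auto
  next
    case (Suc m)
    have "(\<forall>j<Suc m. (c # w) ! j < w ! m) \<longleftrightarrow> c < w ! m \<and> (\<forall>j<m. w ! j < w ! m)"
      by (auto simp: less_Suc_eq_0_disj)
    then show ?thesis using Suc by (auto simp: Cons.IH)
  qed
  then show ?case by blast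
qed simp

lemma strict_sorted_records: "sorted_wrt (<) (records k w)"
  by (induction w arbitrary: k) (auto simp: sorted_wrt_map)

lemma sorted_list_of_ltr_max:
  assumes "\<forall>c\<in>set w. 1 \<le> c"
  shows "sorted_list_of_set (ltr_max w) = records 0 w"
proof -
  have "ltr_max w = set (records 0 w)"
    unfolding set_records ltr_max_def using assms by (auto simp: Suc_le_eq)
  then show ?thesis
    using strict_sorted_records[of 0 w] by (simp add: sorted_list_of_set.idem_if_sorted_distinct strict_sorted_iff)
qed

section \<open>Expectations over geometric words\<close>

definition words :: "nat \<Rightarrow> nat list set" where
  "words n = {w. length w = n \<and> (\<forall>k\<in>set w. 1 \<le> k)}"

definition word_expectation :: "real \<Rightarrow> nat \<Rightarrow> (nat list \<Rightarrow> real) \<Rightarrow> real" where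
  "word_expectation q n F = (\<Sum>\<^sub>\<infinity>w\<in>words n. word_prob q w * F w)"

lemma words_0 [simp]: "words 0 = {[]}"
  by (auto simp: words_def)

lemma words_Suc: "words (Suc n) = (\<lambda>(j, w). Suc j # w) ` (UNIV \<times> words n)"
proof (intro equalityI subsetI)
  fix w assume "w \<in> words (Suc n)"
  then obtain c v where "w = c # v" "length v = n" "1 \<le> c" "\<forall>k\<in>set v. 1 \<le> k"
    by (auto simp: words_def length_Suc_conv)
  then show "w \<in> (\<lambda>(j, w). Suc j # w) ` (UNIV \<times> words n)"
    by (intro image_eqI[of _ _ "(c - 1, v)"]) (auto simp: words_def)
qed (auto simp: words_def)

lemma inj_on_letter_Cons: "inj_on (\<lambda>(j, w). Suc j # w) A"
  by (auto simp: inj_on_def)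

lemma word_prob_Cons [simp]: "word_prob q (Suc j # w) = (1 - q) * q ^ j * word_prob q w"
  by (simp add: word_prob_def)

lemma word_prob_Nil [simp]: "word_prob q [] = 1"
  by (simp add: word_prob_def)

lemma word_prob_nonneg:
  assumes "0 < q" "q < 1"
  shows "0 \<le> word_prob q w"
  unfolding word_prob_def using assms by (induction w) auto

lemma geometric_has_sum:
  fixes q :: real
  assumes "0 < q" "q < 1"
  shows "((\<lambda>j. (1 - q) * q ^ j) has_sum 1) UNIV"
proof (rule norm_summable_imp_has_sum)
  show "(\<lambda>j. (1 - q) * q ^ j) sums 1"
    using sums_mult[OF geometric_sums[of q], of "1 - q"] assms by simp
  show "summable (\<lambda>j. norm ((1 - q) * q ^ j))"
    using assms by (simp add: norm_mult norm_power summable_mult summable_geometric)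
qed

lemma word_prob_has_sum:
  assumes q: "0 < q" "q < 1"
  shows "(word_prob q has_sum 1) (words n)"
proof (induction n)
  case (Suc n)
  let ?g = "\<lambda>(j, w). (1 - q) * q ^ j * word_prob q w"
  have inner: "((\<lambda>w. ?g (j, w)) has_sum (1 - q) * q ^ j) (words n)" for j
    using has_sum_cmult_right[OF Suc, of "(1 - q) * q ^ j"] by simp
  have "?g summable_on (UNIV \<times> words n)"
    using q geometric_has_sum[OF q] inner
    by (intro summable_on_SigmaI[where g = "\<lambda>j. (1 - q) * q ^ j"])
      (auto simp: word_prob_nonneg summable_on_def)
  then have "(?g has_sum 1) (UNIV \<times> words n)"
    using inner geometric_has_sum[OF q] by (intro has_sum_SigmaI[where g = "\<lambda>j. (1 - q) * q ^ j"]) auto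
  moreover have "word_prob q \<circ> (\<lambda>(j, w). Suc j # w) = ?g"
    by auto
  ultimately show ?case
    unfolding words_Suc has_sum_reindex[OF inj_on_letter_Cons] by simp
qed (use has_sum_finite[of "{[]}" "word_prob q"] in simp)

lemma word_summable:
  assumes q: "0 < q" "q < 1" and F: "\<And>w. w \<in> words n \<Longrightarrow> 0 \<le> F w \<and> F w \<le> B"
  shows "(\<lambda>w. word_prob q w * F w) summable_on words n"
proof (rule summable_on_comparison_test)
  show "(\<lambda>w. word_prob q w * B) summable_on words n"
    using word_prob_has_sum[OF q] by (intro summable_on_cmult_left) (auto simp: summable_on_def)
qed (use F word_prob_nonneg[OF q] in \<open>auto intro: mult_left_mono\<close>)

lemma word_expectation_0 [simp]: "word_expectation q 0 F = F []"
  by (simp add: word_expectation_def)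

lemma word_expectation_add:
  assumes q: "0 < q" "q < 1"
    and F: "\<And>w. w \<in> words n \<Longrightarrow> 0 \<le> F w \<and> F w \<le> B"
    and G: "\<And>w. w \<in> words n \<Longrightarrow> 0 \<le> G w \<and> G w \<le> C"
  shows "word_expectation q n (\<lambda>w. F w + G w) = word_expectation q n F + word_expectation q n G"
  unfolding word_expectation_def distrib_left
  using infsum_add[OF word_summable[OF q F] word_summable[OF q G]] by simp

lemma word_expectation_bounds:
  assumes q: "0 < q" "q < 1" and F: "\<And>w. w \<in> words n \<Longrightarrow> 0 \<le> F w \<and> F w \<le> B"
  shows "0 \<le> word_expectation q n F" "word_expectation q n F \<le> B"
proof -
  show "0 \<le> word_expectation q n F"
    unfolding word_expectation_def using F word_prob_nonneg[OF q] by (intro infsum_nonneg) auto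
  have "word_expectation q n F \<le> (\<Sum>\<^sub>\<infinity>w\<in>words n. word_prob q w * B)"
    unfolding word_expectation_def using F word_prob_nonneg[OF q]
    by (intro infsum_mono word_summable[OF q F] summable_on_cmult_left mult_left_mono)
      (use word_prob_has_sum[OF q] in \<open>auto simp: summable_on_def\<close>)
  also have "\<dots> = B"
    using word_prob_has_sum[OF q, of n] by (simp add: infsum_cmult_left' infsumI)
  finally show "word_expectation q n F \<le> B" .
qed

text \<open>Conditioning on the first letter, with boundedness of \<open>F\<close> supplying the
  summability behind the iterated sum. Every first-letter recursion below is an instance.\<close>

lemma word_expectation_Suc:
  assumes q: "0 < q" "q < 1" and F: "\<And>w. w \<in> words (Suc n) \<Longrightarrow> 0 \<le> F w \<and> F w \<le> B"
  shows "(\<lambda>j. (1 - q) * q ^ j * word_expectation q n (\<lambda>w. F (Suc j # w)))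
    sums word_expectation q (Suc n) F"
proof -
  let ?h = "\<lambda>w. word_prob q w * F w"
  let ?g = "\<lambda>(j, w). (1 - q) * q ^ j * (word_prob q w * F (Suc j # w))"
  have eq: "?h \<circ> (\<lambda>(j, w). Suc j # w) = ?g"
    by (auto simp: algebra_simps)
  have "?h summable_on words (Suc n)"
    by (rule word_summable[OF q F])
  then have *: "(?h has_sum word_expectation q (Suc n) F) (words (Suc n))"
    unfolding word_expectation_def by (rule has_sum_infsum)
  then have **: "(?g has_sum word_expectation q (Suc n) F) (UNIV \<times> words n)"
    unfolding words_Suc has_sum_reindex[OF inj_on_letter_Cons] eq by simp
  have "((\<lambda>j. (1 - q) * q ^ j * word_expectation q n (\<lambda>w. F (Suc j # w)))
    has_sum word_expectation q (Suc n) F) UNIV"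
  proof (rule has_sum_SigmaD[OF **])
    fix j :: nat
    have "((\<lambda>w. word_prob q w * F (Suc j # w)) has_sum word_expectation q n (\<lambda>w. F (Suc j # w)))
      (words n)"
      unfolding word_expectation_def
      by (intro has_sum_infsum word_summable[OF q, where B = B] F) (auto simp: words_Suc)
    from has_sum_cmult_right[OF this, of "(1 - q) * q ^ j"]
    show "((\<lambda>w. ?g (j, w)) has_sum (1 - q) * q ^ j * word_expectation q n (\<lambda>w. F (Suc j # w))) (words n)"
      by simp
  qed
  then show ?thesis by (rule has_sum_imp_sums)
qed

section \<open>Number and position of the maxima above a threshold\<close>

definition prob_records :: "real \<Rightarrow> nat \<Rightarrow> nat \<Rightarrow> nat \<Rightarrow> real" where
  "prob_records q k s n = word_expectation q n (\<lambda>w. of_bool (length (records k w) = s))"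

definition prob_records_ge :: "real \<Rightarrow> nat \<Rightarrow> nat \<Rightarrow> nat \<Rightarrow> real" where
  "prob_records_ge q k r n = word_expectation q n (\<lambda>w. of_bool (r \<le> length (records k w)))"

text \<open>The indicator of \<open>E_geom\<close> is absorbed as the default value 0, and the index
  is 0-based, matching \<open>P - 1\<close>.\<close>

definition rth_record :: "nat \<Rightarrow> nat \<Rightarrow> nat list \<Rightarrow> real" where
  "rth_record k r w = (if r \<le> length (records k w) then real (rev (records k w) ! (r - 1)) else 0)"

definition mean_rth_record :: "real \<Rightarrow> nat \<Rightarrow> nat \<Rightarrow> nat \<Rightarrow> real" where
  "mean_rth_record q k r n = word_expectation q n (rth_record k r)"

lemma E_geom_eq_mean_rth_record: "E_geom r q n = mean_rth_record q 0 r n"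
  unfolding E_geom_def mean_rth_record_def word_expectation_def words_def[symmetric]
proof (rule infsum_cong)
  fix w assume "w \<in> words n"
  then have *: "sorted_list_of_set (ltr_max w) = records 0 w"
    by (intro sorted_list_of_ltr_max) (simp add: words_def)
  have "card (ltr_max w) = length (records 0 w)"
    using arg_cong[OF *, of length] by simp
  with * show "word_prob q w * real (rth_ltr_max_idx r w) * (if r \<le> card (ltr_max w) then 1 else 0)
    = word_prob q w * rth_record 0 r w"
    by (simp add: rth_ltr_max_idx_def rth_record_def)
qed

lemma rth_record_bounds:
  assumes "1 \<le> r"
  shows "0 \<le> rth_record k r w \<and> rth_record k r w \<le> real (length w)"
proof (cases "r \<le> length (records k w)")
  case True
  then have "rev (records k w) ! (r - 1) \<in> set (rev (records k w))"
    using assms by (intro nth_mem) auto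
  then have "rev (records k w) ! (r - 1) < length w"
    by (simp add: set_records)
  with True show ?thesis by (simp add: rth_record_def)
qed (simp add: rth_record_def)

text \<open>A prefixed letter shifts each index by one, so the \<open>r\<close>th index from the
  right grows by 1 if it lies in \<open>w\<close>. If the new letter is itself the
  \<open>r\<close>th maximum, its index 0 equals the default value, so this case adds
  nothing.\<close>

lemma rth_record_Cons:
  assumes "1 \<le> r"
  shows "rth_record k r (c # w) =
    rth_record (max k c) r w + of_bool (r \<le> length (records (max k c) w))"
proof (cases "k < c")
  case True
  then have "max k c = c" by simp
  consider "r \<le> length (records c w)" | "r = Suc (length (records c w))" | "r > Suc (length (records c w))"
    by linarith
  then show ?thesis
    using True assms \<open>max k c = c\<close>
    by cases (auto simp: rth_record_def rev_map nth_append)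
next
  case False
  then show ?thesis using assms
    by (auto simp: rth_record_def rev_map max_def)
qed

lemma prob_records_bounds:
  assumes "0 < q" "q < 1"
  shows "0 \<le> prob_records q k s n" "prob_records q k s n \<le> 1"
  unfolding prob_records_def using word_expectation_bounds[OF assms, of n "\<lambda>w. of_bool (length (records k w) = s)" 1]
  by auto

lemma prob_records_ge_bounds:
  assumes "0 < q" "q < 1"
  shows "0 \<le> prob_records_ge q k r n" "prob_records_ge q k r n \<le> 1"
  unfolding prob_records_ge_def using word_expectation_bounds[OF assms, of n "\<lambda>w. of_bool (r \<le> length (records k w))" 1]
  by auto

lemma prob_records_0: "prob_records q k s 0 = of_bool (s = 0)"
  by (auto simp: prob_records_def)

lemma prob_records_ge_0: "prob_records_ge q k r 0 = of_bool (r = 0)"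
  by (simp add: prob_records_ge_def)

lemma prob_records_ge_split:
  assumes "0 < q" "q < 1"
  shows "prob_records_ge q k s n = prob_records q k s n + prob_records_ge q k (Suc s) n"
proof -
  have "(\<lambda>w. of_bool (s \<le> length (records k w)) :: real) =
    (\<lambda>w. of_bool (length (records k w) = s) + of_bool (Suc s \<le> length (records k w)))"
    by (auto simp: fun_eq_iff)
  then show ?thesis
    unfolding prob_records_def prob_records_ge_def
    by (simp only:) (rule word_expectation_add[OF assms, where B = 1 and C = 1], auto)
qed

lemma prob_records_Suc_sums:
  assumes "0 < q" "q < 1"
  shows "(\<lambda>j. (1 - q) * q ^ j * (if j < k then prob_records q k s n
      else if s = 0 then 0 else prob_records q (Suc j) (s - 1) n)) sums prob_records q k s (Suc n)"
proof -
  have *: "word_expectation q n (\<lambda>w. of_bool (length (records k (Suc j # w)) = s)) =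
    (if j < k then prob_records q k s n
      else if s = 0 then 0 else prob_records q (Suc j) (s - 1) n)" for j
  proof -
    have "(\<lambda>w. of_bool (length (records k (Suc j # w)) = s) :: real) =
      (\<lambda>w. if j < k then of_bool (length (records k w) = s) else if s = 0 then 0
        else of_bool (length (records (Suc j) w) = s - 1))"
      by (auto simp: fun_eq_iff)
    then show ?thesis
      by (simp only: prob_records_def) (auto simp: word_expectation_def)
  qed
  show ?thesis
    using word_expectation_Suc[OF assms, of n "\<lambda>w. of_bool (length (records k w) = s)" 1]
    unfolding * prob_records_def[symmetric] by simp
qed

lemma prob_records_ge_Suc_sums:
  assumes "0 < q" "q < 1" and "1 \<le> r"
  shows "(\<lambda>j. (1 - q) * q ^ j * (if j < k then prob_records_ge q k r n
      else prob_records_ge q (Suc j) (r - 1) n)) sums prob_records_ge q k r (Suc n)"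
proof -
  have *: "word_expectation q n (\<lambda>w. of_bool (r \<le> length (records k (Suc j # w)))) =
    (if j < k then prob_records_ge q k r n else prob_records_ge q (Suc j) (r - 1) n)" for j
  proof -
    have "(\<lambda>w. of_bool (r \<le> length (records k (Suc j # w))) :: real) =
      (\<lambda>w. if j < k then of_bool (r \<le> length (records k w))
        else of_bool (r - 1 \<le> length (records (Suc j) w)))"
      using assms(3) by (auto simp: fun_eq_iff)
    then show ?thesis
      by (simp only: prob_records_ge_def) auto
  qed
  show ?thesis
    using word_expectation_Suc[OF assms(1,2), of n "\<lambda>w. of_bool (r \<le> length (records k w))" 1]
    unfolding * prob_records_ge_def[symmetric] by simp
qed

lemma mean_rth_record_Suc_sums:
  assumes q: "0 < q" "q < 1" and r: "1 \<le> r"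
  shows "(\<lambda>j. (1 - q) * q ^ j * (mean_rth_record q (max k (Suc j)) r n
      + prob_records_ge q (max k (Suc j)) r n)) sums mean_rth_record q k r (Suc n)"
proof -
  have *: "word_expectation q n (\<lambda>w. rth_record k r (Suc j # w)) =
    mean_rth_record q (max k (Suc j)) r n + prob_records_ge q (max k (Suc j)) r n" for j
    unfolding rth_record_Cons[OF r] mean_rth_record_def prob_records_ge_def
    by (rule word_expectation_add[OF q, where B = "real n" and C = 1])
      (use rth_record_bounds[OF r] in \<open>auto simp: words_def\<close>)
  have "0 \<le> rth_record k r w \<and> rth_record k r w \<le> real (Suc n)" if "w \<in> words (Suc n)" for w
    using that rth_record_bounds[OF r, of k w] by (simp add: words_def)
  then have "(\<lambda>j. (1 - q) * q ^ j * word_expectation q n (\<lambda>w. rth_record k r (Suc j # w)))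
    sums word_expectation q (Suc n) (rth_record k r)"
    by (rule word_expectation_Suc[OF q])
  then show ?thesis
    unfolding * mean_rth_record_def[symmetric] .
qed

section \<open>Comparison of consecutive thresholds\<close>

text \<open>Letters above \<open>k + 1\<close> become the new threshold whichever of
  \<open>k\<close> and \<open>k + 1\<close> was in force, so their terms cancel and a finite sum
  remains: letters at most \<open>k\<close> contribute the first summand, the letter
  \<open>k + 1\<close> the second.\<close>

lemma threshold_difference:
  fixes q :: real
  assumes A: "(\<lambda>j. (1 - q) * q ^ j * (if j < k then X k else W (Suc j))) sums A"
    and B: "(\<lambda>j. (1 - q) * q ^ j * (if j < Suc k then X (Suc k) else W (Suc j))) sums B"
  shows "A - B = (1 - q ^ k) * (X k - X (Suc k)) + (1 - q) * q ^ k * (W (Suc k) - X (Suc k))"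
proof -
  let ?d = "\<lambda>j. (1 - q) * q ^ j * (if j < k then X k - X (Suc k) else W (Suc j) - X (Suc k))"
  have "(\<lambda>j. if j \<in> {..<Suc k} then ?d j else 0) sums (A - B)"
    by (rule sums_cong[THEN iffD1, OF _ sums_diff[OF A B]]) (auto simp: algebra_simps less_Suc_eq)
  moreover have "(\<lambda>j. if j \<in> {..<Suc k} then ?d j else 0) sums (\<Sum>j<Suc k. ?d j)"
    by (rule sums_If_finite_set) simp
  ultimately have "A - B = (\<Sum>j<Suc k. ?d j)"
    by (rule sums_unique2)
  also have "\<dots> = (1 - q) * (\<Sum>j<k. q ^ j) * (X k - X (Suc k)) + (1 - q) * q ^ k * (W (Suc k) - X (Suc k))"
    by (simp add: sum_distrib_left sum_distrib_right)
  also have "(1 - q) * (\<Sum>j<k. q ^ j) = 1 - q ^ k"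
    by (simp add: one_diff_power_eq)
  finally show ?thesis .
qed

lemma prob_records_diff_Suc:
  assumes q: "0 < q" "q < 1"
  shows "prob_records q k s (Suc n) - prob_records q (Suc k) s (Suc n) =
    (1 - q ^ k) * (prob_records q k s n - prob_records q (Suc k) s n) + (1 - q) * q ^ k *
      ((if s = 0 then 0 else prob_records q (Suc k) (s - 1) n) - prob_records q (Suc k) s n)"
  by (rule threshold_difference[where X = "\<lambda>k. prob_records q k s n"
      and W = "\<lambda>k. if s = 0 then 0 else prob_records q k (s - 1) n"])
    (use prob_records_Suc_sums[OF q] in blast)+

lemma prob_records_ge_diff_Suc:
  assumes q: "0 < q" "q < 1"
  shows "prob_records_ge q k (Suc s) (Suc n) - prob_records_ge q (Suc k) (Suc s) (Suc n) =
    (1 - q ^ k) * (prob_records_ge q k (Suc s) n - prob_records_ge q (Suc k) (Suc s) n)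
      + (1 - q) * q ^ k * prob_records q (Suc k) s n"
proof -
  have "prob_records_ge q k (Suc s) (Suc n) - prob_records_ge q (Suc k) (Suc s) (Suc n) =
    (1 - q ^ k) * (prob_records_ge q k (Suc s) n - prob_records_ge q (Suc k) (Suc s) n)
      + (1 - q) * q ^ k * (prob_records_ge q (Suc k) (Suc s - 1) n - prob_records_ge q (Suc k) (Suc s) n)"
    by (rule threshold_difference[where X = "\<lambda>k. prob_records_ge q k (Suc s) n"
          and W = "\<lambda>k. prob_records_ge q k (Suc s - 1) n"])
      (rule prob_records_ge_Suc_sums[OF q], simp)+
  then show ?thesis
    using prob_records_ge_split[OF q, of "Suc k" s n] by simp
qed

lemma mean_rth_record_diff_Suc:
  assumes q: "0 < q" "q < 1" and r: "1 \<le> r"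
  shows "mean_rth_record q k r (Suc n) - mean_rth_record q (Suc k) r (Suc n) =
    (1 - q ^ k) * ((mean_rth_record q k r n - mean_rth_record q (Suc k) r n)
      + (prob_records_ge q k r n - prob_records_ge q (Suc k) r n))"
proof -
  let ?X = "\<lambda>k. mean_rth_record q k r n + prob_records_ge q k r n"
  have eq: "?X (max k (Suc j)) = (if j < k then ?X k else ?X (Suc j))" for j k
    by (cases "j < k") (simp_all add: max_absorb1 max_absorb2)
  have "mean_rth_record q k r (Suc n) - mean_rth_record q (Suc k) r (Suc n) =
    (1 - q ^ k) * (?X k - ?X (Suc k)) + (1 - q) * q ^ k * (?X (Suc k) - ?X (Suc k))"
    \<comment> \<open>The letter \<open>k + 1\<close> leads to threshold \<open>k + 1\<close> in
      both cases, so taking \<open>X = W\<close> makes the last summand vanish.\<close>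
    by (rule threshold_difference[where X = ?X and W = ?X])
      (use mean_rth_record_Suc_sums[OF q r, of _ n, unfolded eq] in blast)+
  then show ?thesis by (simp add: algebra_simps)
qed

section \<open>Binomial thinning\<close>

text \<open>The expectation of \<open>f\<close> at a binomial variable; in the application
  \<open>y = q ^ k\<close> is the probability that a letter exceeds \<open>k\<close>.\<close>

definition binomial_mean :: "nat \<Rightarrow> real \<Rightarrow> (nat \<Rightarrow> real) \<Rightarrow> real" where
  "binomial_mean n y f = (\<Sum>b\<le>n. real (n choose b) * y ^ b * (1 - y) ^ (n - b) * f b)"

lemma binomial_mean_0 [simp]: "binomial_mean 0 y f = f 0"
  by (simp add: binomial_mean_def)

lemma binomial_mean_Suc:
  "binomial_mean (Suc n) y f = (1 - y) * binomial_mean n y f + y * binomial_mean n y (\<lambda>b. f (Suc b))"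
proof -
  let ?t = "\<lambda>b. real (n choose b) * y ^ b * (1 - y) ^ (Suc n - b) * f b"
  have "binomial_mean (Suc n) y f = (1 - y) ^ Suc n * f 0
    + (\<Sum>b\<le>n. real (Suc n choose Suc b) * y ^ Suc b * (1 - y) ^ (n - b) * f (Suc b))"
    unfolding binomial_mean_def by (subst sum.atMost_Suc_shift) simp
  also have "\<dots> = (1 - y) ^ Suc n * f 0 + (\<Sum>b\<le>n. ?t (Suc b))
    + y * (\<Sum>b\<le>n. real (n choose b) * y ^ b * (1 - y) ^ (n - b) * f (Suc b))"
    by (simp add: algebra_simps sum.distrib sum_distrib_left)
  also have "(1 - y) ^ Suc n * f 0 + (\<Sum>b\<le>n. ?t (Suc b)) = (\<Sum>b\<le>Suc n. ?t b)"
    by (subst sum.atMost_Suc_shift) simp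
  also have "\<dots> = (\<Sum>b\<le>n. ?t b)"
    by simp
  also have "\<dots> = (1 - y) * binomial_mean n y f"
    unfolding binomial_mean_def sum_distrib_left by (intro sum.cong) (auto simp: Suc_diff_le)
  finally show ?thesis by (simp add: binomial_mean_def)
qed

lemma binomial_mean_diff: "binomial_mean n y (\<lambda>b. f b - g b) = binomial_mean n y f - binomial_mean n y g"
  by (simp add: binomial_mean_def right_diff_distrib sum_subtractf)

lemma binomial_mean_cmult: "binomial_mean n y (\<lambda>b. c * f b) = c * binomial_mean n y f"
  by (simp add: binomial_mean_def sum_distrib_left algebra_simps)

lemma binomial_mean_sums:
  assumes "\<And>b. f b sums g b"
  shows "(\<lambda>j. binomial_mean n y (\<lambda>b. f b j)) sums binomial_mean n y g"
  unfolding binomial_mean_def by (intro sums_sum sums_mult assms)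

text \<open>Letters at most \<open>c\<close> have total mass \<open>1 - q ^ c\<close> and keep the
  threshold. Once they are split off, the remaining series has the same shape for every
  \<open>c\<close>, which allows a comparison of the thresholds \<open>c\<close> and
  \<open>c + k\<close>.\<close>

lemma prob_records_Suc:
  assumes q: "0 < q" "q < 1"
  shows "(\<lambda>j. (1 - q) * q ^ (c + j) * (if s = 0 then 0 else prob_records q (Suc (c + j)) (s - 1) n))
    sums (prob_records q c s (Suc n) - (1 - q ^ c) * prob_records q c s n)"
proof -
  have "(\<Sum>j<c. (1 - q) * q ^ j * (if j < c then prob_records q c s n
      else if s = 0 then 0 else prob_records q (Suc j) (s - 1) n)) =
    (1 - q) * (\<Sum>j<c. q ^ j) * prob_records q c s n"
    by (simp add: sum_distrib_left sum_distrib_right)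
  also have "\<dots> = (1 - q ^ c) * prob_records q c s n"
    by (simp add: one_diff_power_eq)
  finally have *: "(\<Sum>j<c. (1 - q) * q ^ j * (if j < c then prob_records q c s n
      else if s = 0 then 0 else prob_records q (Suc j) (s - 1) n)) = (1 - q ^ c) * prob_records q c s n" .
  show ?thesis
    using sums_split_initial_segment[OF prob_records_Suc_sums[OF q, of c s n], of c]
    unfolding * by (simp add: add.commute[of _ c] cong: if_cong)
qed

text \<open>Memorylessness: the letters exceeding \<open>k\<close>, diminished by \<open>k\<close>, again form a word of
  independent geometric letters, of binomially distributed length.\<close>
lemma prob_records_thinning:
  assumes q: "0 < q" "q < 1"
  shows "prob_records q (c + k) s n = binomial_mean n (q ^ k) (prob_records q c s)"
proof (induction n arbitrary: c s)
  case (Suc n)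
  let ?y = "q ^ k"
  let ?W = "\<lambda>d n. if s = 0 then 0 else prob_records q d (s - 1) n"
  have IH: "binomial_mean n ?y (?W d) = ?W (d + k) n" for d
    using Suc.IH[of d "s - 1"] by (auto simp: binomial_mean_def)
  have "(\<lambda>j. binomial_mean n ?y (\<lambda>b. (1 - q) * q ^ (c + j) * ?W (Suc (c + j)) b)) sums
    binomial_mean n ?y (\<lambda>b. prob_records q c s (Suc b) - (1 - q ^ c) * prob_records q c s b)"
    by (rule binomial_mean_sums) (rule prob_records_Suc[OF q])
  \<comment> \<open>The factor \<open>q ^ k\<close> turns the weights belonging to threshold
    \<open>c\<close> into those of threshold \<open>c + k\<close>, so the two evaluations of this
    series must agree.\<close>
  then have "(\<lambda>j. ?y * ((1 - q) * q ^ (c + j) * ?W (Suc (c + j) + k) n)) sums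
    (?y * binomial_mean n ?y (\<lambda>b. prob_records q c s (Suc b) - (1 - q ^ c) * prob_records q c s b))"
    unfolding binomial_mean_cmult IH by (rule sums_mult)
  moreover have "(\<lambda>j. ?y * ((1 - q) * q ^ (c + j) * ?W (Suc (c + j) + k) n)) sums
    (prob_records q (c + k) s (Suc n) - (1 - q ^ (c + k)) * prob_records q (c + k) s n)"
    using prob_records_Suc[OF q, of "c + k" s n]
    by (rule sums_cong[THEN iffD1, rotated]) (auto simp: power_add algebra_simps)
  ultimately have "?y * binomial_mean n ?y (\<lambda>b. prob_records q c s (Suc b) - (1 - q ^ c) * prob_records q c s b) =
    prob_records q (c + k) s (Suc n) - (1 - q ^ (c + k)) * prob_records q (c + k) s n"
    by (rule sums_unique2)
  then have "prob_records q (c + k) s (Suc n) = (1 - q ^ (c + k)) * prob_records q (c + k) s n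
    + ?y * binomial_mean n ?y (\<lambda>b. prob_records q c s (Suc b) - (1 - q ^ c) * prob_records q c s b)"
    by simp
  also have "\<dots> = (1 - q ^ (c + k)) * prob_records q (c + k) s n
    + ?y * (binomial_mean n ?y (\<lambda>b. prob_records q c s (Suc b)) - (1 - q ^ c) * prob_records q (c + k) s n)"
    unfolding binomial_mean_diff binomial_mean_cmult by (simp add: Suc.IH)
  also have "\<dots> = (1 - ?y) * prob_records q (c + k) s n
    + ?y * binomial_mean n ?y (\<lambda>b. prob_records q c s (Suc b))"
    by (simp add: power_add algebra_simps)
  finally show ?case
    by (simp add: binomial_mean_Suc Suc.IH)
qed (simp add: prob_records_0)

text \<open>The probability that a word of length \<open>b\<close> starts with the letter 1 and has exactly \<open>r\<close>
  left-to-right maxima.\<close>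
definition low_start :: "real \<Rightarrow> nat \<Rightarrow> nat \<Rightarrow> real" where
  "low_start q r b = (if b = 0 then 0 else (1 - q) * prob_records q 1 (r - 1) (b - 1))"

text \<open>Since \<open>n choose (b + 1)\<close> equals
  \<open>(n choose b) * (n - b) / (b + 1)\<close>, this is a binomial mean weighted by the mean
  index of the first of \<open>b\<close> uniformly placed letters.\<close>

definition shifted_binomial_mean :: "nat \<Rightarrow> real \<Rightarrow> (nat \<Rightarrow> real) \<Rightarrow> real" where
  "shifted_binomial_mean n y f = (\<Sum>b\<le>n. real (n choose Suc b) * y ^ b * (1 - y) ^ (n - b) * f b)"

text \<open>Pascal's rule. The recursion has the form of \<open>mean_rth_record_diff_Suc\<close>, so
  the two quantities can be identified by induction on \<open>n\<close>.\<close>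

lemma shifted_binomial_mean_Suc:
  "shifted_binomial_mean (Suc n) y f = (1 - y) * (shifted_binomial_mean n y f + binomial_mean n y f)"
proof -
  have "shifted_binomial_mean (Suc n) y f =
    (\<Sum>b\<le>n. real (Suc n choose Suc b) * y ^ b * (1 - y) ^ (Suc n - b) * f b)"
    by (simp add: shifted_binomial_mean_def binomial_eq_0)
  also have "\<dots> = (\<Sum>b\<le>n. (1 - y) * (real (n choose Suc b) * y ^ b * (1 - y) ^ (n - b) * f b
      + real (n choose b) * y ^ b * (1 - y) ^ (n - b) * f b))"
    by (intro sum.cong) (auto simp: Suc_diff_le algebra_simps)
  also have "\<dots> = (1 - y) * (shifted_binomial_mean n y f + binomial_mean n y f)"
    by (simp add: shifted_binomial_mean_def binomial_mean_def sum_distrib_left sum.distrib distrib_left)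
  finally show ?thesis .
qed

text \<open>The left side is the probability that the \<open>r\<close>th maximum from the right has
  value \<open>k + 1\<close>. In that event the letters above \<open>k\<close>, diminished by
  \<open>k\<close>, start with 1 and have exactly \<open>r\<close> maxima.\<close>

lemma prob_records_ge_diff:
  assumes q: "0 < q" "q < 1" and r: "1 \<le> r"
  shows "prob_records_ge q k r n - prob_records_ge q (Suc k) r n = binomial_mean n (q ^ k) (low_start q r)"
proof (induction n)
  case 0
  then show ?case using r by (simp add: prob_records_ge_0 low_start_def)
next
  case (Suc n)
  obtain s where s: "r = Suc s" using r by (cases r) auto
  have "binomial_mean n (q ^ k) (\<lambda>b. low_start q r (Suc b)) = (1 - q) * prob_records q (Suc k) s n"
    using prob_records_thinning[OF q, of 1 k s n]
    by (simp add: low_start_def s binomial_mean_cmult)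
  then show ?case
    using prob_records_ge_diff_Suc[OF q, of k s n] Suc by (simp add: binomial_mean_Suc s)
qed

text \<open>With at least \<open>r\<close> maxima above \<open>k + 1\<close> both thresholds give
  the same index, since the count runs from the right. What remains is the mean index on the event
  that the \<open>r\<close>th maximum has value \<open>k + 1\<close>.\<close>

lemma mean_rth_record_diff:
  assumes q: "0 < q" "q < 1" and r: "1 \<le> r"
  shows "mean_rth_record q k r n - mean_rth_record q (Suc k) r n =
    shifted_binomial_mean n (q ^ k) (low_start q r)"
proof (induction n)
  case 0
  then show ?case using r by (simp add: mean_rth_record_def rth_record_def shifted_binomial_mean_def)
next
  case (Suc n)
  then show ?case
    unfolding mean_rth_record_diff_Suc[OF q r] prob_records_ge_diff[OF q r] shifted_binomial_mean_Suc
    by simp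
qed

section \<open>Decay in the threshold and summation over it\<close>

lemma geometric_weighted_le:
  fixes q :: real
  assumes q: "0 < q" "q < 1" and A: "(\<lambda>j. (1 - q) * q ^ j * x j) sums A" and le: "\<And>j. x j \<le> B"
  shows "A \<le> B"
proof -
  have *: "(\<lambda>j. (1 - q) * q ^ j * B) sums (1 * B)"
    by (intro sums_mult2 has_sum_imp_sums geometric_has_sum q)
  have "A \<le> 1 * B"
  proof (rule sums_le[OF _ A *])
    fix j
    show "(1 - q) * q ^ j * x j \<le> (1 - q) * q ^ j * B"
      using q by (intro mult_left_mono le) auto
  qed
  then show ?thesis by simp
qed

text \<open>A union bound: some letter among \<open>n\<close> has to exceed \<open>k\<close>. This
  decay in \<open>k\<close> feeds the convergence of the telescoping sum.\<close>

lemma prob_records_ge_le: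
  assumes q: "0 < q" "q < 1" and r: "1 \<le> r"
  shows "prob_records_ge q k r n \<le> real n * q ^ k"
proof (induction n)
  case 0
  then show ?case using r by (simp add: prob_records_ge_0)
next
  case (Suc n)
  let ?P = "prob_records_ge q k r n"
  have 1: "(\<lambda>j. (1 - q) * q ^ j * (if j < k then ?P else 1)) sums ((1 - q ^ k) * ?P + q ^ k)"
  proof -
    have "(\<lambda>j. (1 - q) * q ^ (j + k)) sums (q ^ k)"
      using sums_mult[OF has_sum_imp_sums[OF geometric_has_sum[OF q]], of "q ^ k"]
      by (simp add: power_add algebra_simps)
    then have "(\<lambda>j. (1 - q) * q ^ (j + k) * (if j + k < k then ?P else 1)) sums (q ^ k)"
      by simp
    then have "(\<lambda>j. (1 - q) * q ^ j * (if j < k then ?P else 1)) sums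
      (q ^ k + (\<Sum>j<k. (1 - q) * q ^ j * (if j < k then ?P else 1)))"
      by (rule sums_iff_shift[THEN iffD1])
    moreover have "(\<Sum>j<k. (1 - q) * q ^ j * (if j < k then ?P else 1)) = (1 - q) * (\<Sum>j<k. q ^ j) * ?P"
      by (simp add: sum_distrib_left sum_distrib_right)
    ultimately show ?thesis by (simp add: one_diff_power_eq add.commute)
  qed
  have "prob_records_ge q k r (Suc n) \<le> (1 - q ^ k) * ?P + q ^ k"
    by (rule sums_le[OF _ prob_records_ge_Suc_sums[OF q r] 1])
      (use q prob_records_ge_bounds[OF q] in \<open>auto intro!: mult_left_mono\<close>)
  also have "\<dots> \<le> ?P + q ^ k"
    using q prob_records_ge_bounds[OF q, of k r n] by (simp add: algebra_simps)
  also have "\<dots> \<le> real (Suc n) * q ^ k"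
    using Suc by (simp add: algebra_simps)
  finally show ?case .
qed

lemma mean_rth_record_le:
  assumes q: "0 < q" "q < 1" and r: "1 \<le> r"
  shows "mean_rth_record q k r n \<le> real n ^ 2 * q ^ k"
proof (induction n arbitrary: k)
  case 0
  then show ?case using r by (simp add: mean_rth_record_def rth_record_def)
next
  case (Suc n)
  show ?case
  proof (rule geometric_weighted_le[OF q mean_rth_record_Suc_sums[OF q r]])
    fix j
    have "mean_rth_record q (max k (Suc j)) r n + prob_records_ge q (max k (Suc j)) r n
      \<le> (real n ^ 2 + real n) * q ^ max k (Suc j)"
      using Suc[of "max k (Suc j)"] prob_records_ge_le[OF q r, of "max k (Suc j)" n]
      by (simp add: algebra_simps)
    also have "\<dots> \<le> real (Suc n) ^ 2 * q ^ k"
      using q by (intro mult_mono power_decreasing) (auto simp: power2_eq_square algebra_simps)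
    finally show "mean_rth_record q (max k (Suc j)) r n + prob_records_ge q (max k (Suc j)) r n
      \<le> real (Suc n) ^ 2 * q ^ k" .
  qed
qed

text \<open>The differences over consecutive thresholds telescope from threshold 0 to the limit 0;
  the \<open>k\<close>th term is the share of words whose \<open>r\<close>th maximum has value
  \<open>k + 1\<close>.\<close>

lemma E_geom_sums:
  assumes q: "0 < q" "q < 1" and r: "1 \<le> r"
  shows "(\<lambda>k. shifted_binomial_mean n (q ^ k) (low_start q r)) sums E_geom r q n"
proof -
  have "(\<lambda>k. mean_rth_record q k r n) \<longlonglongrightarrow> 0"
  proof (rule tendsto_sandwich[where f = "\<lambda>_. 0" and h = "\<lambda>k. real n ^ 2 * q ^ k"])
    show "(\<lambda>k. real n ^ 2 * q ^ k) \<longlonglongrightarrow> 0"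
      using q by (intro tendsto_mult_right_zero LIMSEQ_realpow_zero) auto
    show "\<forall>\<^sub>F k in sequentially. 0 \<le> mean_rth_record q k r n"
      unfolding mean_rth_record_def using rth_record_bounds[OF r]
      by (intro always_eventually allI word_expectation_bounds(1)[OF q, where B = "real n"])
        (auto simp: words_def)
  qed (use mean_rth_record_le[OF q r] in auto)
  from telescope_sums'[OF this] show ?thesis
    by (simp add: mean_rth_record_diff[OF q r] E_geom_eq_mean_rth_record)
qed

lemma low_start_bounds:
  assumes q: "0 < q" "q < 1"
  shows "0 \<le> low_start q r b" "low_start q r b \<le> 1"
  using prob_records_bounds[OF q, of 1 "r - 1" "b - 1"] q
  by (auto simp: low_start_def mult_le_one)

section \<open>Poisson approximation\<close>

definition poisson :: "real \<Rightarrow> nat \<Rightarrow> real" where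
  "poisson x m = exp (- x) * x ^ m / fact m"

lemma poisson_nonneg: "0 \<le> x \<Longrightarrow> 0 \<le> poisson x m"
  by (simp add: poisson_def)

text \<open>The moment generating function of the Poisson distribution.\<close>

lemma poisson_exp_sums: "(\<lambda>m. poisson x m * exp (y * real m)) sums exp (x * (exp y - 1))"
proof -
  have "(\<lambda>m. exp (- x) * ((x * exp y) ^ m /\<^sub>R fact m)) sums (exp (- x) * exp (x * exp y))"
    by (intro sums_mult exp_converges)
  moreover have "exp (- x) * ((x * exp y) ^ m /\<^sub>R fact m) = poisson x m * exp (y * real m)" for m
    by (simp add: poisson_def power_mult_distrib exp_of_nat_mult[symmetric] mult.commute field_simps)
  moreover have "exp (- x) * exp (x * exp y) = exp (x * (exp y - 1))"
    by (simp add: exp_add[symmetric] algebra_simps)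
  ultimately show ?thesis by simp
qed

lemma poisson_sums: "poisson x sums 1"
  using poisson_exp_sums[of x 0] by simp

lemma summable_poisson_weighted:
  assumes "0 \<le> x" and f: "\<And>m. 0 \<le> f m \<and> f m \<le> (1::real)"
  shows "summable (\<lambda>m. poisson x m * f m)"
proof (rule summable_comparison_test[OF _ sums_summable[OF poisson_sums[of x]]])
  show "\<exists>N. \<forall>m\<ge>N. norm (poisson x m * f m) \<le> poisson x m"
    using poisson_nonneg[OF assms(1)] f by (auto simp: abs_mult intro!: mult_left_le)
qed

lemma binomial_mean_one: "binomial_mean n y (\<lambda>_. 1) = 1"
  using binomial_ring[of y "1 - y" n] by (simp add: binomial_mean_def)

text \<open>Uses \<open>n choose m \<le> n ^ m / m!\<close> and
  \<open>1 - y \<le> exp (- y)\<close>; having the exponent \<open>n - m\<close> in place of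
  \<open>n\<close> costs the factor \<open>exp (y * m)\<close>.\<close>

lemma binomial_term_le_poisson:
  assumes y: "0 \<le> y" "y \<le> 1" and m: "m \<le> n"
  shows "real (n choose m) * y ^ m * (1 - y) ^ (n - m) \<le> poisson (real n * y) m * exp (y * real m)"
proof -
  have "real (n choose m) * fact m \<le> real n ^ m"
    using binomial_fact_pow[of n m] by (metis of_nat_fact of_nat_le_iff of_nat_mult of_nat_power)
  then have 1: "real (n choose m) \<le> real n ^ m / fact m"
    by (simp add: field_simps)
  have "(1 - y) ^ (n - m) \<le> exp (- y) ^ (n - m)"
    using y exp_ge_add_one_self[of "- y"] by (intro power_mono) auto
  also have "\<dots> = exp (- (real n * y)) * exp (y * real m)"
    using m by (simp add: exp_of_nat_mult[symmetric] exp_add[symmetric] of_nat_diff algebra_simps)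
  finally have 2: "(1 - y) ^ (n - m) \<le> exp (- (real n * y)) * exp (y * real m)" .
  have "real (n choose m) * y ^ m * (1 - y) ^ (n - m) \<le>
    real n ^ m / fact m * y ^ m * (exp (- (real n * y)) * exp (y * real m))"
    using y 1 2 by (intro mult_mono) auto
  then show ?thesis
    by (simp add: poisson_def power_mult_distrib algebra_simps)
qed

text \<open>Because \<open>f \<le> 1\<close>, the excess of the majorant over the Poisson weights
  contributes at most its total mass, which the moment generating function evaluates.\<close>

lemma binomial_mean_le_poisson:
  assumes y: "0 \<le> y" "y \<le> 1" and f: "\<And>m. 0 \<le> f m \<and> f m \<le> 1"
  shows "binomial_mean n y f \<le> (\<Sum>m. poisson (real n * y) m * f m) + (exp (real n * y * (exp y - 1)) - 1)"
proof -
  let ?x = "real n * y"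
  let ?u = "\<lambda>m. poisson ?x m * f m + (poisson ?x m * exp (y * real m) - poisson ?x m)"
  have x: "0 \<le> ?x" using y by simp
  have u: "?u sums ((\<Sum>m. poisson ?x m * f m) + (exp (?x * (exp y - 1)) - 1))"
    by (intro sums_add sums_diff poisson_sums poisson_exp_sums summable_sums
        summable_poisson_weighted x f)
  have le: "poisson ?x m * exp (y * real m) * f m \<le> ?u m" for m
  proof -
    have "poisson ?x m * (exp (y * real m) - 1) * f m \<le> poisson ?x m * (exp (y * real m) - 1) * 1"
      using f y by (intro mult_left_mono mult_nonneg_nonneg poisson_nonneg x) auto
    then show ?thesis by (simp add: algebra_simps)
  qed
  have nonneg: "0 \<le> ?u m" for m
    using le[of m] f[of m] poisson_nonneg[OF x, of m]
    by (meson exp_ge_zero mult_nonneg_nonneg order_trans)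
  have "binomial_mean n y f \<le> (\<Sum>m\<le>n. ?u m)"
    unfolding binomial_mean_def
    by (intro sum_mono order_trans[OF mult_right_mono[OF binomial_term_le_poisson[OF y]] le])
      (use f in auto)
  also have "\<dots> \<le> suminf ?u"
    using u nonneg by (intro sum_le_suminf) (auto simp: sums_iff)
  finally show ?thesis using u by (simp add: sums_iff)
qed

text \<open>The two-sided bound comes from applying the one-sided bound to \<open>f\<close> and to \<open>1 - f\<close>.\<close>
lemma binomial_mean_poisson_error:
  assumes y: "0 \<le> y" "y \<le> 1" and f: "\<And>m. 0 \<le> f m \<and> f m \<le> 1"
  shows "\<bar>binomial_mean n y f - (\<Sum>m. poisson (real n * y) m * f m)\<bar> \<le> exp (real n * y * (exp y - 1)) - 1"
proof -
  let ?x = "real n * y"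
  have "0 \<le> ?x" using y by simp
  then have "(\<Sum>m. poisson ?x m * (1 - f m)) = 1 - (\<Sum>m. poisson ?x m * f m)"
    using suminf_diff[OF sums_summable[OF poisson_sums[of ?x]] summable_poisson_weighted[OF _ f]]
      sums_unique[OF poisson_sums[of ?x]]
    by (simp add: right_diff_distrib)
  moreover have "binomial_mean n y (\<lambda>m. 1 - f m) = 1 - binomial_mean n y f"
    by (simp add: binomial_mean_diff binomial_mean_one)
  ultimately show ?thesis
    using binomial_mean_le_poisson[OF y, of f n] binomial_mean_le_poisson[OF y, of "\<lambda>m. 1 - f m" n] f
    by (simp add: abs_le_iff)
qed

lemma binomial_mean_nonneg:
  assumes "0 \<le> y" "y \<le> 1" "\<And>b. 0 \<le> f b"
  shows "0 \<le> binomial_mean n y f"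
  unfolding binomial_mean_def using assms by (intro sum_nonneg) auto

lemma binomial_mean_le_1:
  assumes "0 \<le> y" "y \<le> 1" "\<And>b. f b \<le> 1"
  shows "binomial_mean n y f \<le> 1"
  using binomial_mean_nonneg[OF assms(1,2), of "\<lambda>b. 1 - f b" n] assms(3)
  by (simp add: binomial_mean_diff binomial_mean_one)

section \<open>The limit profile and bounds for the thinned sums\<close>

text \<open>The properties of \<open>low_start q r\<close> on which the asymptotic analysis
  rests.\<close>

locale record_weights =
  fixes S :: "nat \<Rightarrow> real"
  assumes S_0 [simp]: "S 0 = 0" and S_nonneg: "0 \<le> S b" and S_le_1: "S b \<le> 1"
begin

definition profile :: "real \<Rightarrow> real" where
  "profile x = exp (- x) * (\<Sum>b. S b / fact (Suc b) * x ^ b)"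

lemma summable_profile: "summable (\<lambda>b. S b / fact (Suc b) * x ^ b)" for x :: real
proof (rule summable_comparison_test[OF _ summable_exp[of "\<bar>x\<bar>"]])
  have "norm (S b / fact (Suc b) * x ^ b) \<le> inverse (fact b) * \<bar>x\<bar> ^ b" for b
  proof -
    have "S b / fact (Suc b) \<le> 1 / fact b"
      using S_le_1[of b] S_nonneg[of b] by (intro frac_le fact_mono) auto
    then have "S b / fact (Suc b) * \<bar>x\<bar> ^ b \<le> 1 / fact b * \<bar>x\<bar> ^ b"
      by (intro mult_right_mono) auto
    then show ?thesis
      using S_nonneg[of b] by (simp add: abs_mult power_abs divide_inverse del: fact_Suc)
  qed
  then show "\<exists>N. \<forall>b\<ge>N. norm (S b / fact (Suc b) * x ^ b) \<le> inverse (fact b) * \<bar>x\<bar> ^ b"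
    by blast
qed

lemma isCont_profile: "isCont profile x"
  unfolding profile_def[abs_def]
  by (intro continuous_intros isCont_powser_converges_everywhere summable_profile)

lemma profile_nonneg: "0 \<le> x \<Longrightarrow> 0 \<le> profile x"
  unfolding profile_def using S_nonneg
  by (intro mult_nonneg_nonneg suminf_nonneg summable_profile) auto

text \<open>The factor \<open>x\<close> turns \<open>x ^ b / (b + 1)!\<close> into a Poisson weight
  at \<open>b + 1\<close>. The term \<open>m = 0\<close> vanishes because \<open>0 - 1 = 0\<close>
  on naturals and \<open>S 0 = 0\<close>.\<close>

lemma mult_profile:
  "x * profile x = (\<Sum>m. poisson x m * S (m - 1))"
proof -
  have "(\<lambda>b. exp (- x) * x * (S b / fact (Suc b) * x ^ b)) sums (exp (- x) * x * (\<Sum>b. S b / fact (Suc b) * x ^ b))"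
    by (intro sums_mult summable_sums summable_profile)
  moreover have "exp (- x) * x * (S b / fact (Suc b) * x ^ b) = poisson x (Suc b) * S (Suc b - 1)" for b
    by (simp add: poisson_def)
  moreover have "exp (- x) * x * (\<Sum>b. S b / fact (Suc b) * x ^ b) = x * profile x"
    by (simp add: profile_def)
  ultimately have "(\<lambda>b. poisson x (Suc b) * S (Suc b - 1)) sums (x * profile x)"
    by (simp only:)
  then have "(\<lambda>m. poisson x m * S (m - 1)) sums (x * profile x)"
    by (subst (asm) sums_Suc_iff) simp
  then show ?thesis by (simp add: sums_iff)
qed

lemma profile_le_inverse:
  assumes "0 < x"
  shows "profile x \<le> 1 / x"
proof -
  have "(\<Sum>m. poisson x m * S (m - 1)) \<le> suminf (poisson x)"
    using assms S_le_1 S_nonneg poisson_nonneg[of x]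
    by (intro suminf_le summable_poisson_weighted sums_summable[OF poisson_sums]) (auto intro: mult_left_le)
  also have "\<dots> = 1" by (rule sums_unique[OF poisson_sums, symmetric])
  finally show ?thesis
    using assms unfolding mult_profile[symmetric] by (simp add: field_simps)
qed

text \<open>As \<open>S 0 = 0\<close>, the series starts with the first power of \<open>x\<close>
  and is dominated by \<open>x * exp x\<close>.\<close>

lemma profile_le:
  assumes "0 \<le> x"
  shows "profile x \<le> x"
proof -
  have 1: "(\<lambda>b. S (Suc b) / fact (Suc (Suc b)) * x ^ Suc b) sums (\<Sum>b. S b / fact (Suc b) * x ^ b)"
    using summable_sums[OF summable_profile[of x]] by (subst sums_Suc_iff) simp
  have 2: "(\<lambda>b. x * (x ^ b /\<^sub>R fact b)) sums (x * exp x)"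
    by (intro sums_mult exp_converges)
  have "(\<Sum>b. S b / fact (Suc b) * x ^ b) \<le> x * exp x"
  proof (rule sums_le[OF _ 1 2])
    fix b
    have "S (Suc b) / fact (Suc (Suc b)) \<le> 1 / fact b"
      using S_le_1[of "Suc b"] S_nonneg[of "Suc b"] by (intro frac_le fact_mono) auto
    then have "S (Suc b) / fact (Suc (Suc b)) * x ^ Suc b \<le> 1 / fact b * x ^ Suc b"
      using assms by (intro mult_right_mono) auto
    then show "S (Suc b) / fact (Suc (Suc b)) * x ^ Suc b \<le> x * (x ^ b /\<^sub>R fact b)"
      by (simp add: field_simps)
  qed
  then have "exp (- x) * (\<Sum>b. S b / fact (Suc b) * x ^ b) \<le> exp (- x) * (x * exp x)"
    by (intro mult_left_mono) auto
  also have "\<dots> = x" by (simp add: exp_minus)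
  finally show ?thesis unfolding profile_def .
qed

text \<open>The binomial counterpart of \<open>mult_profile\<close>; the factor \<open>1 - y\<close>
  arises because the exponent \<open>n - b\<close> exceeds \<open>n - (b + 1)\<close> by
  one.\<close>

lemma mult_shifted_binomial_mean:
  "y * shifted_binomial_mean n y S = (1 - y) * binomial_mean n y (\<lambda>m. S (m - 1))"
proof (cases n)
  case 0
  then show ?thesis by (simp add: shifted_binomial_mean_def binomial_mean_def)
next
  case (Suc k)
  have "y * shifted_binomial_mean n y S =
    (\<Sum>b\<le>k. y * (real (n choose Suc b) * y ^ b * (1 - y) ^ (n - b) * S b))"
    by (simp add: shifted_binomial_mean_def Suc sum_distrib_left binomial_eq_0)
  also have "\<dots> = (\<Sum>b\<le>k. (1 - y) * (real (n choose Suc b) * y ^ Suc b * (1 - y) ^ (n - Suc b) * S b))"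
    by (intro sum.cong) (auto simp: Suc Suc_diff_le)
  also have "\<dots> = (1 - y) * binomial_mean n y (\<lambda>m. S (m - 1))"
    unfolding binomial_mean_def Suc by (subst sum.atMost_Suc_shift) (simp add: sum_distrib_left)
  finally show ?thesis .
qed

lemma shifted_binomial_mean_nonneg:
  assumes "0 \<le> y" "y \<le> 1"
  shows "0 \<le> shifted_binomial_mean n y S"
  unfolding shifted_binomial_mean_def using assms S_nonneg by (intro sum_nonneg) auto

lemma shifted_binomial_mean_le_inverse:
  assumes y: "0 < y" "y \<le> 1"
  shows "shifted_binomial_mean n y S \<le> 1 / y"
proof -
  have "(1 - y) * binomial_mean n y (\<lambda>m. S (m - 1)) \<le> 1 * 1"
    using y S_le_1 S_nonneg by (intro mult_mono binomial_mean_le_1 binomial_mean_nonneg) auto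
  then show ?thesis
    using y unfolding mult_shifted_binomial_mean[symmetric] by (simp add: field_simps)
qed

lemma binomial_mean_le:
  assumes y: "0 \<le> y" "y \<le> 1"
  shows "binomial_mean n y S \<le> real n * y"
proof (induction n)
  case (Suc n)
  have "binomial_mean (Suc n) y S \<le> 1 * binomial_mean n y S + y * 1"
    unfolding binomial_mean_Suc using y S_le_1 S_nonneg
    by (intro add_mono mult_mono binomial_mean_le_1 binomial_mean_nonneg) auto
  with Suc show ?case by (simp add: algebra_simps)
qed simp

text \<open>Divided by \<open>n\<close>, this and \<open>shifted_binomial_mean_le_inverse\<close>
  become the bounds \<open>x\<close> and \<open>1 / x\<close> at \<open>x = n * y\<close>, the same
  as those for \<open>profile\<close>.\<close>

lemma shifted_binomial_mean_le:
  assumes y: "0 \<le> y" "y \<le> 1"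
  shows "shifted_binomial_mean n y S \<le> real n ^ 2 * y"
proof (induction n)
  case 0
  then show ?case by (simp add: shifted_binomial_mean_def)
next
  case (Suc n)
  have "shifted_binomial_mean (Suc n) y S \<le> 1 * (shifted_binomial_mean n y S + binomial_mean n y S)"
    unfolding shifted_binomial_mean_Suc using y S_nonneg
    by (intro mult_right_mono add_nonneg_nonneg binomial_mean_nonneg shifted_binomial_mean_nonneg) auto
  also have "\<dots> \<le> (real n ^ 2 + real n) * y"
    using Suc binomial_mean_le[OF y, of n] by (simp add: algebra_simps)
  also have "\<dots> \<le> real (Suc n) ^ 2 * y"
    using y by (intro mult_right_mono) (auto simp: power2_eq_square algebra_simps)
  finally show ?case .
qed

text \<open>After multiplication by \<open>x = n * y\<close> both quantities are means of
  \<open>S (m - 1)\<close>, binomial and Poisson, except for the factor \<open>1 - y\<close>; that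
  factor costs at most \<open>y\<close>, hence \<open>1 / n\<close> after division by
  \<open>x\<close>.\<close>

lemma shifted_binomial_mean_profile_error:
  assumes y: "0 < y" "y \<le> 1" and n: "0 < n"
  shows "\<bar>shifted_binomial_mean n y S / real n - profile (real n * y)\<bar> \<le>
    1 / real n + (exp (real n * y * (exp y - 1)) - 1) / (real n * y)"
proof -
  let ?x = "real n * y" and ?f = "\<lambda>m. S (m - 1)"
  have x: "0 < ?x" using y n by simp
  have B: "0 \<le> binomial_mean n y ?f" "binomial_mean n y ?f \<le> 1"
    using y S_nonneg S_le_1 by (auto intro!: binomial_mean_nonneg binomial_mean_le_1)
  have "?x * (shifted_binomial_mean n y S / real n - profile ?x) = y * shifted_binomial_mean n y S - ?x * profile ?x"
    using n by (simp add: field_simps)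
  also have "\<dots> = (binomial_mean n y ?f - (\<Sum>m. poisson ?x m * ?f m)) - y * binomial_mean n y ?f"
    unfolding mult_shifted_binomial_mean mult_profile by (simp add: algebra_simps)
  finally have *: "?x * (shifted_binomial_mean n y S / real n - profile ?x) =
    (binomial_mean n y ?f - (\<Sum>m. poisson ?x m * ?f m)) - y * binomial_mean n y ?f" .
  have "\<bar>binomial_mean n y ?f - (\<Sum>m. poisson ?x m * ?f m)\<bar> \<le> exp (?x * (exp y - 1)) - 1"
    using y S_nonneg S_le_1 by (intro binomial_mean_poisson_error) auto
  moreover have "0 \<le> y * binomial_mean n y ?f" "y * binomial_mean n y ?f \<le> y"
    using y B by (auto simp: mult_left_le)
  ultimately have "\<bar>?x * (shifted_binomial_mean n y S / real n - profile ?x)\<bar> \<le>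
    (exp (?x * (exp y - 1)) - 1) + y"
    unfolding * by linarith
  then have "\<bar>shifted_binomial_mean n y S / real n - profile ?x\<bar> \<le> ((exp (?x * (exp y - 1)) - 1) + y) / ?x"
    using x y unfolding abs_mult by (simp add: pos_le_divide_eq mult.commute)
  also have "\<dots> = 1 / real n + (exp (?x * (exp y - 1)) - 1) / ?x"
    using y n by (simp add: field_simps)
  finally show ?thesis .
qed

end

section \<open>An antiderivative of the profile on the logarithmic scale\<close>

definition poisson_below :: "nat \<Rightarrow> real \<Rightarrow> real" where
  "poisson_below b x = (\<Sum>i<b. poisson x i)"

lemma DERIV_poisson_Suc:
  "((\<lambda>x. poisson x (Suc b)) has_real_derivative (poisson x b - poisson x (Suc b))) (at x within A)"
proof -
  have "((\<lambda>x. exp (- x) * x ^ Suc b / fact (Suc b)) has_real_derivative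
    (exp (- x) * (real (Suc b) * x ^ b) - exp (- x) * x ^ Suc b) / fact (Suc b)) (at x within A)"
    by (auto intro!: derivative_eq_intros simp del: fact_Suc power_Suc)
  moreover have "exp (- x) * (real (Suc b) * x ^ b) / fact (Suc b) = exp (- x) * x ^ b / fact b"
    unfolding fact_Suc by (simp del: of_nat_Suc)
  ultimately show ?thesis
    unfolding poisson_def diff_divide_distrib by (simp only:)
qed

text \<open>The derivatives of successive Poisson weights telescope, so the Poisson distribution
  function integrates a single weight.\<close>

lemma DERIV_poisson_below:
  "(poisson_below (Suc b) has_real_derivative (- poisson x b)) (at x within A)"
proof (induction b)
  case 0
  have "poisson_below (Suc 0) = (\<lambda>x. exp (- x))"
    by (auto simp: poisson_below_def poisson_def)
  then show ?case by (auto intro!: derivative_eq_intros simp: poisson_def)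
next
  case (Suc b)
  have "poisson_below (Suc (Suc b)) = (\<lambda>x. poisson_below (Suc b) x + poisson x (Suc b))"
    by (auto simp: poisson_below_def)
  then show ?case
    using DERIV_add[OF Suc DERIV_poisson_Suc[of b]] by simp
qed

lemma poisson_below_bounds:
  assumes "0 \<le> x"
  shows "0 \<le> poisson_below b x" "poisson_below b x \<le> 1"
proof -
  show "0 \<le> poisson_below b x"
    unfolding poisson_below_def using poisson_nonneg[OF assms] by (intro sum_nonneg) auto
  have "poisson_below b x \<le> suminf (poisson x)"
    unfolding poisson_below_def using poisson_nonneg[OF assms] poisson_sums[of x]
    by (intro sum_le_suminf) (auto simp: sums_iff)
  then show "poisson_below b x \<le> 1"
    using sums_unique[OF poisson_sums[of x]] by simp
qed

lemma poisson_below_at_top: "(poisson_below b \<longlongrightarrow> 0) at_top"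
proof -
  have "((\<lambda>x. poisson x i) \<longlongrightarrow> 0) at_top" for i
  proof -
    have "((\<lambda>x::real. x ^ i / exp x / fact i) \<longlongrightarrow> 0 / fact i) at_top"
      by (intro tendsto_divide tendsto_power_div_exp_0 tendsto_const) simp
    then show ?thesis
      by (simp add: poisson_def exp_minus field_simps)
  qed
  then have "((\<lambda>x. \<Sum>i<b. poisson x i) \<longlongrightarrow> (\<Sum>i<b. 0)) at_top"
    by (intro tendsto_sum)
  then show ?thesis by (simp add: poisson_below_def[abs_def])
qed

lemma poisson_below_at_0: "poisson_below (Suc b) 0 = 1"
  unfolding poisson_below_def by (subst sum.lessThan_Suc_shift) (simp add: poisson_def)

lemma inverse_consecutive_sums: "(\<lambda>b. 1 / (real (Suc b) * real (Suc (Suc b)))) sums 1"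
proof -
  have "(\<lambda>b. 1 / real (Suc b) - 1 / real (Suc (Suc b))) sums (1 / real (Suc 0) - 0)"
    by (rule telescope_sums'[OF LIMSEQ_Suc[OF lim_1_over_n]])
  moreover have "1 / real (Suc b) - 1 / real (Suc (Suc b)) = 1 / (real (Suc b) * real (Suc (Suc b)))" for b
    by (simp add: field_simps)
  ultimately show ?thesis by simp
qed

lemma tendsto_suminf_dominated:
  fixes a :: "nat \<Rightarrow> 'n \<Rightarrow> real"
  assumes "\<And>k. (a k \<longlongrightarrow> b k) F" and bound: "\<forall>\<^sub>F n in F. \<forall>k. \<bar>a k n\<bar> \<le> M k"
    and "summable M" "F \<noteq> bot"
  shows "((\<lambda>n. \<Sum>k. a k n) \<longlongrightarrow> (\<Sum>k. b k)) F"
proof -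
  have "\<forall>\<^sub>F (k, n) in at_top \<times>\<^sub>F F. norm (a k n) \<le> M k"
    using bound unfolding eventually_prod_filter
    by (intro exI[of _ "\<lambda>_. True"] exI[of _ "\<lambda>n. \<forall>k. \<bar>a k n\<bar> \<le> M k"]) auto
  from tannerys_theorem[OF assms(1) this assms(3,4)] show ?thesis by blast
qed

context record_weights
begin

text \<open>The coefficients \<open>S b / (b * (b + 1))\<close>, shifted by one to start at
  \<open>b = 1\<close>.\<close>

definition tail_coeff :: "nat \<Rightarrow> real" where
  "tail_coeff b = S (Suc b) / (real (Suc b) * real (Suc (Suc b)))"

lemma tail_coeff_bounds:
  "0 \<le> tail_coeff b" "tail_coeff b \<le> 1 / (real (Suc b) * real (Suc (Suc b)))" "tail_coeff b \<le> 1"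
proof -
  show "0 \<le> tail_coeff b" using S_nonneg by (simp add: tail_coeff_def)
  show *: "tail_coeff b \<le> 1 / (real (Suc b) * real (Suc (Suc b)))"
    unfolding tail_coeff_def using S_le_1 by (intro divide_right_mono) auto
  have "1 * 1 \<le> real (Suc b) * real (Suc (Suc b))"
    by (intro mult_mono) auto
  then have "1 / (real (Suc b) * real (Suc (Suc b))) \<le> 1"
    by (subst divide_le_eq_1) auto
  with * show "tail_coeff b \<le> 1" by linarith
qed

lemma summable_tail_coeff: "summable tail_coeff"
  by (rule summable_comparison_test[OF _ sums_summable[OF inverse_consecutive_sums]])
    (use tail_coeff_bounds in auto)

text \<open>For \<open>x > 0\<close> this is the integral of \<open>profile t / t\<close> from
  \<open>x\<close> to infinity, computed term by term.\<close>

definition profile_tail :: "real \<Rightarrow> real" where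
  "profile_tail x = (\<Sum>b. tail_coeff b * poisson_below (Suc b) x)"

lemma profile_tail_0: "profile_tail 0 = suminf tail_coeff"
  by (simp add: profile_tail_def poisson_below_at_0)

lemma profile_tail_at_top: "(profile_tail \<longlongrightarrow> 0) at_top"
proof -
  have "((\<lambda>x. \<Sum>b. tail_coeff b * poisson_below (Suc b) x) \<longlongrightarrow> (\<Sum>b. 0)) at_top"
  proof (rule tendsto_suminf_dominated[where M = tail_coeff])
    show "((\<lambda>x. tail_coeff b * poisson_below (Suc b) x) \<longlongrightarrow> 0) at_top" for b
      by (intro tendsto_mult_right_zero poisson_below_at_top)
    show "\<forall>\<^sub>F x in at_top. \<forall>b. \<bar>tail_coeff b * poisson_below (Suc b) x\<bar> \<le> tail_coeff b"
      using eventually_ge_at_top[of "0::real"]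
      by eventually_elim
        (use tail_coeff_bounds poisson_below_bounds in \<open>auto simp: abs_mult intro!: mult_left_le\<close>)
  qed (auto intro: summable_tail_coeff)
  then show ?thesis by (simp add: profile_tail_def[abs_def])
qed

text \<open>Termwise differentiation on a symmetric interval containing \<open>x\<close>, with the
  exponential series as majorant. Allowing every real \<open>x\<close> gives continuity at 0, where
  the value is the sum of the coefficients.\<close>

lemma DERIV_profile_tail:
  "(profile_tail has_real_derivative (\<Sum>b. - (tail_coeff b * poisson x b))) (at x)"
proof -
  define R where "R = \<bar>x\<bar> + 1"
  have R: "0 < R" by (simp add: R_def)
  show ?thesis
    unfolding profile_tail_def[abs_def]
  proof (rule has_field_derivative_series'(2)[where S = "{-R<..<R}" and ?x0.0 = 0])
    show "((\<lambda>x. tail_coeff b * poisson_below (Suc b) x) has_real_derivative - (tail_coeff b * poisson y b))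
      (at y within {-R<..<R})" for b y
      using DERIV_cmult[OF DERIV_poisson_below, of "tail_coeff b"] by simp
    show "uniformly_convergent_on {-R<..<R} (\<lambda>n y. \<Sum>i<n. - (tail_coeff i * poisson y i))"
    proof (rule Weierstrass_m_test')
      show "summable (\<lambda>i. exp R * (inverse (fact i) * R ^ i))"
        by (intro summable_mult summable_exp)
      fix i y assume y: "y \<in> {-R<..<R}"
      have "\<bar>y\<bar> ^ i \<le> R ^ i" "exp (- y) \<le> exp R"
        using y by (auto intro: power_mono)
      then have "exp (- y) * \<bar>y\<bar> ^ i / fact i \<le> exp R * R ^ i / fact i"
        by (intro divide_right_mono mult_mono) auto
      then have "tail_coeff i * (exp (- y) * \<bar>y\<bar> ^ i / fact i) \<le> 1 * (exp R * R ^ i / fact i)"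
        using tail_coeff_bounds[of i] by (intro mult_mono) auto
      then show "norm (- (tail_coeff i * poisson y i)) \<le> exp R * (inverse (fact i) * R ^ i)"
        using tail_coeff_bounds[of i] by (simp add: poisson_def abs_mult power_abs divide_inverse algebra_simps)
    qed
    show "summable (\<lambda>b. tail_coeff b * poisson_below (Suc b) 0)"
      by (simp add: poisson_below_at_0 summable_tail_coeff)
  qed (auto simp: R_def)
qed

lemma DERIV_profile_tail_pos:
  assumes "0 < x"
  shows "(profile_tail has_real_derivative (- profile x / x)) (at x)"
proof -
  have "(\<lambda>b. S (Suc b) / fact (Suc (Suc b)) * x ^ Suc b) sums (\<Sum>b. S b / fact (Suc b) * x ^ b)"
    using summable_sums[OF summable_profile[of x]] by (subst sums_Suc_iff) simp
  from sums_mult[OF this, of "- exp (- x) / x"]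
  have "(\<lambda>b. - exp (- x) / x * (S (Suc b) / fact (Suc (Suc b)) * x ^ Suc b)) sums (- profile x / x)"
    by (simp add: profile_def)
  moreover have "- exp (- x) / x * (S (Suc b) / fact (Suc (Suc b)) * x ^ Suc b) = - (tail_coeff b * poisson x b)" for b
    using assms by (simp add: tail_coeff_def poisson_def field_simps)
  ultimately have "(\<lambda>b. - (tail_coeff b * poisson x b)) sums (- profile x / x)"
    by (simp only:)
  then show ?thesis
    using DERIV_profile_tail[of x] by (simp add: sums_iff)
qed

lemma isCont_profile_tail: "isCont profile_tail x"
  using DERIV_profile_tail by (rule DERIV_isCont)

end

section \<open>Periodisation\<close>

lemma summable_on_powr_abs_int:
  fixes Q :: real
  assumes "1 < Q"
  shows "(\<lambda>k::int. Q powr - real_of_int \<bar>k\<bar>) summable_on UNIV"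
proof -
  have *: "(\<lambda>n::nat. Q powr - real n) summable_on UNIV"
  proof (rule norm_summable_imp_summable_on)
    have "(\<lambda>n. norm (Q powr - real n)) = (\<lambda>n. (1 / Q) ^ n)"
      using assms by (auto simp: powr_minus powr_realpow field_simps power_one_over)
    then show "summable (\<lambda>n. norm (Q powr - real n))"
      using assms by (simp add: summable_geometric)
  qed
  have 1: "(\<lambda>k::int. Q powr - real_of_int \<bar>k\<bar>) summable_on (range int)"
    by (subst summable_on_reindex) (use * in \<open>auto simp: o_def\<close>)
  have 2: "(\<lambda>k::int. Q powr - real_of_int \<bar>k\<bar>) summable_on (range (\<lambda>n. - int n))"
    by (subst summable_on_reindex) (use * in \<open>auto simp: o_def inj_on_def\<close>)
  have "range int \<union> (range (\<lambda>n. - int n) - range int) = UNIV"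
    by (auto simp: image_iff) (metis int_cases2)
  then show ?thesis
    using summable_on_Un_disjoint[OF 1 summable_on_subset_banach[OF 2, of "range (\<lambda>n. - int n) - range int"]]
    by auto
qed

text \<open>Enumerating the integers by \<open>int_decode\<close> makes Tannery's theorem for series
  available for two-sided sums.\<close>

lemma infsum_int_eq_suminf:
  fixes f :: "int \<Rightarrow> real"
  assumes "f summable_on UNIV"
  shows "(\<lambda>n. f (int_decode n)) sums (\<Sum>\<^sub>\<infinity>k. f k)"
proof -
  have "(f has_sum (\<Sum>\<^sub>\<infinity>k. f k)) (range int_decode)"
    using has_sum_infsum[OF assms] surj_int_decode by simp
  then have "(f \<circ> int_decode has_sum (\<Sum>\<^sub>\<infinity>k. f k)) UNIV"
    by (simp add: has_sum_reindex inj_int_decode)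
  then show ?thesis
    using has_sum_imp_sums by (fastforce simp: o_def)
qed

lemma tendsto_infsum_int_dominated:
  fixes a :: "int \<Rightarrow> 'n \<Rightarrow> real"
  assumes lim: "\<And>k. (a k \<longlongrightarrow> 0) F" and bound: "\<forall>\<^sub>F n in F. \<forall>k. \<bar>a k n\<bar> \<le> M k"
    and M: "M summable_on UNIV" and F: "F \<noteq> bot"
  shows "((\<lambda>n. \<Sum>\<^sub>\<infinity>k. a k n) \<longlongrightarrow> 0) F"
proof -
  have "((\<lambda>n. \<Sum>j. a (int_decode j) n) \<longlongrightarrow> (\<Sum>j. 0)) F"
    by (rule tendsto_suminf_dominated[where M = "\<lambda>j. M (int_decode j)"])
      (use lim bound F infsum_int_eq_suminf[OF M] in \<open>auto elim: eventually_mono simp: sums_iff\<close>)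
  moreover have "\<forall>\<^sub>F n in F. (\<Sum>\<^sub>\<infinity>k. a k n) = (\<Sum>j. a (int_decode j) n)"
    using bound
  proof eventually_elim
    case (elim n)
    have "(\<lambda>k. norm (a k n)) summable_on UNIV"
      using elim by (intro summable_on_comparison_test[OF M]) auto
    then have "(\<lambda>k. a k n) summable_on UNIV"
      by (rule abs_summable_summable)
    from infsum_int_eq_suminf[OF this] show ?case by (simp add: sums_iff)
  qed
  ultimately show ?thesis by (simp add: tendsto_cong)
qed

text \<open>Passes from unconditional sums to symmetric partial sums, whose integrals
  telescope.\<close>

lemma filterlim_int_intervals:
  "filterlim (\<lambda>K. {- int K..int K}) (finite_subsets_at_top UNIV) sequentially"
  unfolding filterlim_finite_subsets_at_top
proof (intro allI impI)
  fix X :: "int set" assume "finite X \<and> X \<subseteq> UNIV"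
  then obtain B where B: "\<And>k. k \<in> X \<Longrightarrow> \<bar>k\<bar> \<le> B"
    by (metis finite_imageI[of X abs] image_eqI Max_ge)
  show "\<forall>\<^sub>F K in sequentially. finite {- int K..int K} \<and> X \<subseteq> {- int K..int K} \<and> {- int K..int K} \<subseteq> UNIV"
    using eventually_ge_at_top[of "nat B"]
    by eventually_elim (use B in \<open>force simp: abs_le_iff\<close>)
qed

lemma sum_int_telescope:
  fixes f :: "int \<Rightarrow> real"
  shows "(\<Sum>k = - int K..int K. f (- k) - f (1 - k)) = f (- int K) - f (int K + 1)"
proof (induction K)
  case (Suc K)
  have "{- int (Suc K)..int (Suc K)} = insert (- int (Suc K)) (insert (int (Suc K)) {- int K..int K})"
    by auto
  then show ?case using Suc by (simp add: algebra_simps)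
qed simp

text \<open>For \<open>k \<ge> 0\<close> the bound \<open>x\<close> is the small one, for
  \<open>k < 0\<close> the bound \<open>1 / x\<close>.\<close>

lemma two_sided_powr_bound:
  fixes Q :: real
  assumes "1 < Q" "\<bar>u\<bar> \<le> R"
    and v: "v \<le> Q powr (u - real_of_int k)" "v \<le> 1 / Q powr (u - real_of_int k)"
  shows "v \<le> Q powr R * Q powr - real_of_int \<bar>k\<bar>"
proof -
  let ?x = "Q powr (u - real_of_int k)"
  have "v \<le> Q powr (R - real_of_int \<bar>k\<bar>)"
  proof (cases "0 \<le> k")
    case True
    have "?x \<le> Q powr (R - real_of_int \<bar>k\<bar>)"
      using assms(1,2) True by (intro powr_mono) auto
    then show ?thesis using v by linarith
  next
    case False
    have "1 / ?x = Q powr (real_of_int k - u)"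
      using assms by (simp add: powr_minus[symmetric] divide_inverse)
    also have "\<dots> \<le> Q powr (R - real_of_int \<bar>k\<bar>)"
      using assms(1,2) False by (intro powr_mono) auto
    finally show ?thesis using v by linarith
  qed
  then show ?thesis by (simp add: powr_add[symmetric])
qed

section \<open>The periodised profile: continuity, period and mean\<close>

context record_weights
begin

definition periodised :: "real \<Rightarrow> real \<Rightarrow> real" where
  "periodised Q u = (\<Sum>\<^sub>\<infinity>k::int. profile (Q powr (u - real_of_int k)))"

lemma profile_powr_bound:
  assumes "1 < Q" "\<bar>u\<bar> \<le> R"
  shows "\<bar>profile (Q powr (u - real_of_int k))\<bar> \<le> Q powr R * Q powr - real_of_int \<bar>k\<bar>"
  using two_sided_powr_bound[OF assms, of _ k] assms profile_nonneg profile_le profile_le_inverse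
  by simp

lemma summable_profile_powr:
  assumes "1 < Q"
  shows "(\<lambda>k::int. profile (Q powr (u - real_of_int k))) summable_on UNIV"
proof (rule summable_on_comparison_test)
  show "(\<lambda>k::int. Q powr \<bar>u\<bar> * Q powr - real_of_int \<bar>k\<bar>) summable_on UNIV"
    by (intro summable_on_cmult_right summable_on_powr_abs_int assms)
  show "profile (Q powr (u - real_of_int k)) \<le> Q powr \<bar>u\<bar> * Q powr - real_of_int \<bar>k\<bar>" for k
    using profile_powr_bound[OF assms, of u "\<bar>u\<bar>" k] by auto
qed (auto intro: profile_nonneg)

lemma periodised_shift:
  "periodised Q u = (\<Sum>\<^sub>\<infinity>k::int. profile (Q powr (u - real_of_int (k + m))))"
  unfolding periodised_def
  by (rule infsum_reindex_bij_witness[of _ "\<lambda>k. k + m" "\<lambda>k. k - m"]) auto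

lemma periodised_periodic: "periodised Q (u + 1) = periodised Q u"
  by (subst periodised_shift[of _ _ 1]) (simp add: periodised_def)

lemma uniform_limit_periodised:
  assumes "1 < Q"
  shows "uniform_limit {-R..R} (\<lambda>X u. \<Sum>k\<in>X. profile (Q powr (u - real_of_int k)))
    (periodised Q) (finite_subsets_at_top UNIV)"
  unfolding periodised_def[abs_def]
proof (rule Weierstrass_m_test_general)
  show "(\<lambda>k::int. Q powr R * Q powr - real_of_int \<bar>k\<bar>) summable_on UNIV"
    by (intro summable_on_cmult_right summable_on_powr_abs_int assms)
qed (use profile_powr_bound[OF assms] in auto)

lemma continuous_profile_powr:
  assumes "1 < Q"
  shows "continuous_on A (\<lambda>u. profile (Q powr (u - v)))"
  using assms by (intro continuous_at_imp_continuous_on ballI isCont_o2[OF _ isCont_profile])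
    (auto intro!: continuous_intros)

lemma continuous_periodised:
  assumes "1 < Q"
  shows "continuous_on UNIV (periodised Q)"
proof (intro continuous_at_imp_continuous_on ballI)
  fix u :: real
  define R where "R = \<bar>u\<bar> + 1"
  have "continuous_on {-R..R} (periodised Q)"
    by (rule uniform_limit_theorem[OF _ uniform_limit_periodised[OF assms]])
      (auto intro!: always_eventually continuous_on_sum continuous_profile_powr assms)
  moreover have "u \<in> interior {-R..R}" by (auto simp: R_def interior_atLeastAtMost_real)
  ultimately show "isCont (periodised Q) u"
    by (rule continuous_on_interior)
qed

text \<open>The substitution \<open>x = Q powr (u - v)\<close> has \<open>dx / x = ln Q du\<close>,
  so \<open>profile_tail\<close> provides the antiderivative.\<close>

lemma integral_profile_powr:
  assumes "1 < Q"
  shows "((\<lambda>u. profile (Q powr (u - v))) has_integral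
    ((profile_tail (Q powr - v) - profile_tail (Q powr (1 - v))) / ln Q)) {0..1}"
proof -
  have "((\<lambda>u. - profile_tail (Q powr (u - v)) / ln Q) has_real_derivative profile (Q powr (u - v)))
    (at u within {0..1})" for u
  proof -
    have "((\<lambda>u. Q powr (u - v)) has_real_derivative Q powr (u - v) * ln Q) (at u)"
      using assms by (auto intro!: derivative_eq_intros)
    from DERIV_chain2[OF DERIV_profile_tail_pos this] assms
    have "((\<lambda>u. profile_tail (Q powr (u - v))) has_real_derivative
      - profile (Q powr (u - v)) / Q powr (u - v) * (Q powr (u - v) * ln Q)) (at u)"
      by simp
    from DERIV_cdivide[OF DERIV_minus[OF this], of "ln Q"] show ?thesis
      using assms by (auto intro: has_field_derivative_at_within)
  qed
  then have "((\<lambda>u. profile (Q powr (u - v))) has_integral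
    (- profile_tail (Q powr (1 - v)) / ln Q - - profile_tail (Q powr (0 - v)) / ln Q)) {0..1}"
    by (intro fundamental_theorem_of_calculus)
      (auto simp: has_real_derivative_iff_has_vector_derivative[symmetric])
  then show ?thesis by (simp add: diff_divide_distrib)
qed

text \<open>Translates of the unit interval fill the line, so the mean is the integral of
  \<open>profile x / x\<close> over the positive axis divided by \<open>ln Q\<close>, namely
  \<open>profile_tail 0 / ln Q\<close>.\<close>

lemma integral_periodised:
  assumes Q: "1 < Q"
  shows "integral {0..1} (periodised Q) = suminf tail_coeff / ln Q"
proof -
  let ?f = "\<lambda>K u. \<Sum>k = - int K..int K. profile (Q powr (u - real_of_int k))"
  let ?I = "\<lambda>K. (profile_tail (Q powr - real K) - profile_tail (Q powr (real K + 1))) / ln Q"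
  have "uniform_limit {-1..1} ?f (periodised Q) sequentially"
    using uniform_limit_periodised[OF Q, of 1] filterlim_int_intervals
    unfolding uniform_limit_iff filterlim_iff by blast
  then have "uniform_limit {0..1} ?f (periodised Q) sequentially"
    by (rule uniform_limit_on_subset) auto
  then obtain I J where I: "\<And>K. (?f K has_integral I K) {0..1}" and J: "(periodised Q has_integral J) {0..1}"
    and lim: "I \<longlonglongrightarrow> J"
    by (rule uniform_limit_integral) (auto intro!: continuous_on_sum continuous_profile_powr Q)
  have "(?f K has_integral ?I K) {0..1}" for K
  proof -
    let ?g = "\<lambda>j. profile_tail (Q powr real_of_int j) / ln Q"
    have "(?f K has_integral (\<Sum>k = - int K..int K. ?g (- k) - ?g (1 - k))) {0..1}"
      using integral_profile_powr[OF Q] by (intro has_integral_sum) (auto simp: diff_divide_distrib)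
    then show ?thesis
      unfolding sum_int_telescope[of ?g] by (simp add: diff_divide_distrib add.commute)
  qed
  then have I_eq: "I = ?I"
    using I has_integral_unique by blast
  have "(\<lambda>K. Q powr - real K) \<longlonglongrightarrow> 0"
    using Q LIMSEQ_realpow_zero[of "1 / Q"] by (simp add: powr_minus powr_realpow field_simps power_one_over)
  then have 1: "(\<lambda>K. profile_tail (Q powr - real K)) \<longlonglongrightarrow> profile_tail 0"
    by (rule isCont_tendsto_compose[OF isCont_profile_tail])
  have "filterlim (\<lambda>K. Q powr (real K + 1)) at_top sequentially"
    using Q by real_asymp
  then have 2: "(\<lambda>K. profile_tail (Q powr (real K + 1))) \<longlonglongrightarrow> 0"
    by (rule filterlim_compose[OF profile_tail_at_top])
  have "?I \<longlonglongrightarrow> (profile_tail 0 - 0) / ln Q"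
    using Q by (intro tendsto_divide tendsto_diff 1 2 tendsto_const) auto
  then have "J = profile_tail 0 / ln Q"
    using lim LIMSEQ_unique unfolding I_eq by fastforce
  then show ?thesis
    using J by (simp add: profile_tail_0 integral_unique)
qed

section \<open>Comparison of the expectation with the periodised profile\<close>

lemma shifted_binomial_mean_has_sum_int:
  assumes q: "0 < q" "q < 1" and E: "(\<lambda>k. shifted_binomial_mean n (q ^ k) S) sums E"
  shows "((\<lambda>k::int. if 0 \<le> k then shifted_binomial_mean n (q ^ nat k) S / real n else 0)
    has_sum (E / real n)) UNIV" (is "(?g has_sum _) _")
proof -
  have sums: "(\<lambda>k. shifted_binomial_mean n (q ^ k) S / real n) sums (E / real n)"
    by (intro sums_divide E)
  have "((\<lambda>k. shifted_binomial_mean n (q ^ k) S / real n) has_sum (E / real n)) UNIV"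
    using sums q by (intro norm_summable_imp_has_sum)
      (auto simp: sums_iff shifted_binomial_mean_nonneg power_le_one)
  then have "(?g has_sum (E / real n)) (range int)"
    by (subst has_sum_reindex) (auto simp: o_def)
  then show ?thesis
    by (subst has_sum_cong_neutral[of "range int" UNIV ?g ?g]) (auto simp: image_iff, metis nat_0_le)
qed

text \<open>Shifting the index by the integer part of \<open>log Q n\<close> centres both sums, and
  dominated convergence applies to their termwise difference.\<close>

lemma periodised_asymptotics:
  assumes q: "0 < q" "q < 1"
    and E: "\<And>n. (\<lambda>k. shifted_binomial_mean n (q ^ k) S) sums E n"
  shows "(\<lambda>n. E n / real n - periodised (1 / q) (log (1 / q) (real n))) \<longlonglongrightarrow> 0"
proof -
  define Q where "Q = 1 / q"
  have Q: "1 < Q" using q by (simp add: Q_def)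
  define N where "N n = \<lfloor>log Q (real n)\<rfloor>" for n :: nat
  define \<theta> where "\<theta> n = log Q (real n) - real_of_int (N n)" for n :: nat
  have \<theta>: "0 \<le> \<theta> n" "\<theta> n \<le> 1" for n
    unfolding \<theta>_def N_def by linarith+
  define g where "g n k = (if 0 \<le> k then shifted_binomial_mean n (q ^ nat k) S / real n else 0)"
    for n :: nat and k :: int
  define a where "a k n = g n (k + N n) - profile (Q powr (\<theta> n - real_of_int k))" for k n
  let ?M = "\<lambda>k::int. Q powr 1 * Q powr - real_of_int \<bar>k\<bar>"
  \<comment> \<open>After the shift the argument depends on \<open>n\<close> only through the
    fractional part \<open>\<theta> n\<close>.\<close>
  have scale: "real n * q ^ nat (k + N n) = Q powr (\<theta> n - real_of_int k)"
    if "0 < n" "0 \<le> k + N n" for n k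
  proof -
    have "q ^ nat (k + N n) = Q powr - real_of_int (k + N n)"
    proof -
      have "real_of_int (k + N n) = real (nat (k + N n))"
        using that by simp
      then show ?thesis
        using q Q by (simp only: powr_minus powr_realpow) (simp add: Q_def power_one_over inverse_eq_divide)
    qed
    moreover have "real n = Q powr log Q (real n)"
      using that Q by (simp add: powr_log_cancel)
    ultimately have "real n * q ^ nat (k + N n) = Q powr log Q (real n) * Q powr - real_of_int (k + N n)"
      by simp
    then show ?thesis
      by (simp add: powr_add[symmetric] \<theta>_def algebra_simps)
  qed
  have y: "0 < q ^ m" "q ^ m \<le> 1" for m
    using q by (auto simp: power_le_one)
  have g_bound: "\<bar>g n (k + N n)\<bar> \<le> ?M k" if n: "0 < n" for n k
  proof (cases "0 \<le> k + N n")
    case True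
    let ?y = "q ^ nat (k + N n)"
    have "shifted_binomial_mean n ?y S / real n \<le> real n * ?y"
      using shifted_binomial_mean_le[of ?y n] y[of "nat (k + N n)"] n by (simp add: field_simps power2_eq_square)
    moreover have "shifted_binomial_mean n ?y S / real n \<le> 1 / (real n * ?y)"
      using divide_right_mono[OF shifted_binomial_mean_le_inverse[OF y, of n "nat (k + N n)"], of "real n"]
      by (simp add: mult.commute)
    ultimately have "shifted_binomial_mean n ?y S / real n \<le> ?M k"
      unfolding scale[OF n True] using \<theta>[of n] by (intro two_sided_powr_bound[OF Q, of "\<theta> n"]) auto
    moreover have "0 \<le> shifted_binomial_mean n ?y S / real n"
      using y[of "nat (k + N n)"] by (simp add: shifted_binomial_mean_nonneg)
    ultimately show ?thesis using True by (simp add: g_def)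
  qed (simp add: g_def)
  have sum_a: "(\<Sum>\<^sub>\<infinity>k. a k n) = E n / real n - periodised Q (log Q (real n))" if n: "0 < n" for n
  proof -
    have bij: "bij_betw (\<lambda>k. k + N n) UNIV UNIV"
      by (rule bij_betwI[where g = "\<lambda>k. k - N n"]) auto
    have 1: "((\<lambda>k. g n (k + N n)) has_sum (E n / real n)) UNIV"
      using shifted_binomial_mean_has_sum_int[OF q E, of n]
      unfolding has_sum_reindex_bij_betw[OF bij, of "g n"] by (simp add: g_def[abs_def])
    have "((\<lambda>k. profile (Q powr (log Q (real n) - real_of_int k))) has_sum periodised Q (log Q (real n))) UNIV"
      unfolding periodised_def by (intro has_sum_infsum summable_profile_powr Q)
    then have "((\<lambda>k. profile (Q powr (log Q (real n) - real_of_int (k + N n)))) has_sum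
      periodised Q (log Q (real n))) UNIV"
      unfolding has_sum_reindex_bij_betw[OF bij, of "\<lambda>k. profile (Q powr (log Q (real n) - real_of_int k))"] .
    moreover have "log Q (real n) - real_of_int (k + N n) = \<theta> n - real_of_int k" for k
      by (simp add: \<theta>_def)
    ultimately have 2: "((\<lambda>k. profile (Q powr (\<theta> n - real_of_int k))) has_sum
      periodised Q (log Q (real n))) UNIV"
      by (simp only:)
    show ?thesis
      unfolding a_def using has_sum_add[OF 1 has_sum_cmult_right[OF 2, of "-1"]]
      by (intro infsumI) simp
  qed
  have "(\<lambda>n. \<Sum>\<^sub>\<infinity>k. a k n) \<longlonglongrightarrow> 0"
  proof (rule tendsto_infsum_int_dominated)
    show "(\<lambda>k. 2 * ?M k) summable_on UNIV"
      by (intro summable_on_cmult_right summable_on_powr_abs_int Q)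
    show "\<forall>\<^sub>F n in sequentially. \<forall>k. \<bar>a k n\<bar> \<le> 2 * ?M k"
      using eventually_gt_at_top[of 0]
    proof eventually_elim
      case (elim n)
      have "\<bar>a k n\<bar> \<le> \<bar>g n (k + N n)\<bar> + \<bar>profile (Q powr (\<theta> n - real_of_int k))\<bar>" for k
        by (simp add: a_def)
      moreover have "\<bar>profile (Q powr (\<theta> n - real_of_int k))\<bar> \<le> ?M k" for k
        using \<theta>[of n] by (intro profile_powr_bound Q) auto
      ultimately show ?case using g_bound[OF elim] by (smt (verit))
    qed
    fix k :: int
    \<comment> \<open>Since \<open>\<theta> n\<close> lies in \<open>[0, 1]\<close>, for fixed
      \<open>k\<close> the argument stays between \<open>\<alpha>\<close> and
      \<open>\<beta>\<close>, which makes the Poisson error uniform.\<close>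
    define \<alpha> where "\<alpha> = Q powr - real_of_int k"
    define \<beta> where "\<beta> = Q powr (1 - real_of_int k)"
    have \<alpha>: "0 < \<alpha>" and \<beta>: "0 < \<beta>" using Q by (auto simp: \<alpha>_def \<beta>_def)
    let ?e = "\<lambda>n. 1 / real n + (exp (\<beta> * (exp (\<beta> / real n) - 1)) - 1) / \<alpha>"
    show "a k \<longlonglongrightarrow> 0"
    proof (rule Lim_null_comparison)
      show "?e \<longlonglongrightarrow> 0"
      proof -
        have "?e \<longlonglongrightarrow> 0 + (exp (\<beta> * (exp 0 - 1)) - 1) / \<alpha>"
          using \<alpha> by (intro tendsto_intros lim_1_over_n lim_const_over_n) auto
        then show ?thesis by simp
      qed
      \<comment> \<open>For \<open>\<alpha> \<le> n\<close> the shifted index \<open>k + N n\<close>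
        is nonnegative, so \<open>g\<close> is not at its default value 0.\<close>
      have "\<forall>\<^sub>F n in sequentially. \<alpha> \<le> real n"
        by (rule eventually_mono[OF eventually_ge_at_top[of "nat \<lceil>\<alpha>\<rceil>"]]) linarith
      then show "\<forall>\<^sub>F n in sequentially. norm (a k n) \<le> ?e n"
        using eventually_gt_at_top[of 0]
      proof eventually_elim
        case (elim n)
        have "- real_of_int k = log Q \<alpha>"
          using Q by (simp add: \<alpha>_def)
        also have "\<dots> \<le> log Q (real n)"
          using elim \<alpha> Q by simp
        finally have k: "0 \<le> k + N n"
          unfolding N_def by linarith
        let ?y = "q ^ nat (k + N n)"
        let ?x = "real n * ?y"
        have x: "\<alpha> \<le> ?x" "?x \<le> \<beta>"
          unfolding scale[OF elim(2) k] \<alpha>_def \<beta>_def using \<theta>[of n] Q by (auto intro!: powr_mono)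
        then have "?y \<le> \<beta> / real n"
          using elim by (simp add: field_simps)
        then have *: "?x * (exp ?y - 1) \<le> \<beta> * (exp (\<beta> / real n) - 1)"
          using x \<beta> y[of "nat (k + N n)"] by (intro mult_mono) auto
        have "0 \<le> ?x * (exp ?y - 1)"
          using y[of "nat (k + N n)"] by simp
        with * x \<alpha> have "(exp (?x * (exp ?y - 1)) - 1) / ?x \<le> (exp (\<beta> * (exp (\<beta> / real n) - 1)) - 1) / \<alpha>"
          by (intro frac_le) auto
        moreover have "\<bar>a k n\<bar> \<le> 1 / real n + (exp (?x * (exp ?y - 1)) - 1) / ?x"
          using shifted_binomial_mean_profile_error[OF y elim(2), of "nat (k + N n)"] k
          by (simp add: a_def g_def scale[OF elim(2) k, symmetric])
        ultimately show ?case by simp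
      qed
    qed
  qed auto
  moreover have "\<forall>\<^sub>F n in sequentially. (\<Sum>\<^sub>\<infinity>k. a k n) = E n / real n - periodised Q (log Q (real n))"
    using eventually_gt_at_top[of 0] by eventually_elim (rule sum_a)
  ultimately show ?thesis
    unfolding Q_def by (simp add: tendsto_cong)
qed

end

section \<open>The limit q to 1\<close>

text \<open>The distribution of the number of left-to-right maxima of a uniformly random permutation.\<close>
fun perm_records :: "nat \<Rightarrow> nat \<Rightarrow> real" where
  "perm_records s 0 = of_bool (s = 0)"
| "perm_records s (Suc n) =
    (real n * perm_records s n + (if s = 0 then 0 else perm_records (s - 1) n)) / real (Suc n)"

lemma perm_records_bounds: "0 \<le> perm_records s n" "perm_records s n \<le> 1"
proof (induction n arbitrary: s)
  case (Suc n)
  {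
    case 1
    then show ?case using Suc by simp
  next
    case 2
    have "real n * perm_records s n + (if s = 0 then 0 else perm_records (s - 1) n) \<le> real n * 1 + 1"
      using Suc by (intro add_mono mult_left_mono) auto
    then show ?case by simp
  }
qed auto

text \<open>By the recursion, the increments of \<open>perm_records (Suc s) m / (m + 1)\<close> are
  the terms for \<open>s\<close> minus twice those for \<open>Suc s\<close>. They telescope to 0, so
  each step in \<open>s\<close> halves the sum.\<close>

lemma perm_records_sums:
  "(\<lambda>m. perm_records s m / (real (Suc m) * real (Suc (Suc m)))) sums (1 / 2) ^ Suc s"
proof (induction s)
  case 0
  have "perm_records 0 m = of_bool (m = 0)" for m
    by (induction m) auto
  then have "(\<lambda>m. perm_records 0 m / (real (Suc m) * real (Suc (Suc m)))) = (\<lambda>m. if m = 0 then 1 / 2 else 0)"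
    by (auto simp: fun_eq_iff)
  then show ?case using sums_single[of 0 "\<lambda>_. 1 / 2 :: real"] by simp
next
  case (Suc s)
  let ?v = "\<lambda>m. perm_records (Suc s) m / real (Suc m)"
  let ?x = "\<lambda>m. real (Suc m) * real (Suc (Suc m))"
  have "?v \<longlonglongrightarrow> 0"
  proof (rule tendsto_sandwich[of "\<lambda>_. 0" _ _ "\<lambda>m. 1 / real (Suc m)"])
    show "(\<lambda>m. 1 / real (Suc m)) \<longlonglongrightarrow> 0"
      by (rule LIMSEQ_Suc[OF lim_1_over_n])
  qed (auto intro!: always_eventually divide_right_mono divide_nonneg_nonneg perm_records_bounds)
  from telescope_sums[OF this] have "(\<lambda>m. ?v (Suc m) - ?v m) sums 0"
    by simp
  moreover have "?v (Suc m) - ?v m = perm_records s m / ?x m - 2 * (perm_records (Suc s) m / ?x m)" for m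
    by (simp add: divide_simps) (simp add: algebra_simps)
  ultimately have "(\<lambda>m. perm_records s m / ?x m - 2 * (perm_records (Suc s) m / ?x m)) sums 0"
    by (simp only:)
  from sums_mult[OF sums_diff[OF Suc this], of "1 / 2"] show ?case by simp
qed

text \<open>Thinning by one level and the first-letter recursion give two relations between
  thresholds 0 and 1. Eliminating threshold 1 at length \<open>n + 1\<close> leaves a factor
  \<open>1 - q\<close> on both sides; cancelling it makes the formula regular at
  \<open>q = 1\<close>.\<close>

lemma prob_records_recursion:
  assumes q: "0 < q" "q < 1"
  shows "prob_records q 0 s (Suc n) =
    ((\<Sum>b\<le>n. real (Suc n choose b) * q ^ b * (1 - q) ^ (n - b) * prob_records q 0 s b)
      + (if s = 0 then 0 else prob_records q 1 (s - 1) n) - prob_records q 1 s n) / (\<Sum>i\<le>n. q ^ i)"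
proof -
  let ?T = "\<Sum>b\<le>n. real (Suc n choose b) * q ^ b * (1 - q) ^ (n - b) * prob_records q 0 s b"
  let ?W = "if s = 0 then 0 else prob_records q 1 (s - 1) n"
  let ?G = "\<Sum>i\<le>n. q ^ i"
  have "(\<Sum>b\<le>n. real (Suc n choose b) * q ^ b * (1 - q) ^ (Suc n - b) * prob_records q 0 s b) = (1 - q) * ?T"
    unfolding sum_distrib_left by (intro sum.cong) (auto simp: Suc_diff_le)
  then have "prob_records q 1 s (Suc n) = (1 - q) * ?T + q ^ Suc n * prob_records q 0 s (Suc n)"
    using prob_records_thinning[OF q, of 0 1 s "Suc n"] by (simp add: binomial_mean_def)
  moreover have "prob_records q 0 s (Suc n) - prob_records q 1 s (Suc n) = (1 - q) * (?W - prob_records q 1 s n)"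
    using prob_records_diff_Suc[OF q, of 0 s n] by simp
  ultimately have "(1 - q ^ Suc n) * prob_records q 0 s (Suc n) = (1 - q) * (?T + ?W - prob_records q 1 s n)"
    by (simp add: algebra_simps)
  moreover have "1 - q ^ Suc n = (1 - q) * ?G"
    unfolding one_diff_power_eq lessThan_Suc_atMost ..
  ultimately have "?G * prob_records q 0 s (Suc n) = ?T + ?W - prob_records q 1 s n"
    using q by simp
  moreover have "0 < ?G" using q by (intro sum_pos) auto
  ultimately show ?thesis by (simp add: field_simps)
qed

lemma eventually_at_left_1: "\<forall>\<^sub>F q in at_left 1. 0 < q \<and> q < (1::real)"
  using eventually_at_left_real[of 0 "1::real"] by (auto elim: eventually_mono)

text \<open>Strong induction on the length through the regular recursion. The limits for both
  thresholds agree because their difference carries the factor \<open>1 - q\<close>.\<close>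

lemma prob_records_tendsto:
  "((\<lambda>q. prob_records q 0 s n) \<longlongrightarrow> perm_records s n) (at_left 1) \<and>
   ((\<lambda>q. prob_records q 1 s n) \<longlongrightarrow> perm_records s n) (at_left 1)"
proof (induction n arbitrary: s rule: less_induct)
  case (less n)
  show ?case
  proof (cases n)
    case 0
    then show ?thesis by (simp add: prob_records_0)
  next
    case (Suc m)
    let ?W = "\<lambda>q. if s = 0 then 0 else prob_records q 1 (s - 1) m"
    let ?w = "if s = 0 then 0 else perm_records (s - 1) m"
    have W: "(?W \<longlongrightarrow> ?w) (at_left 1)"
      using less[of m "s - 1"] Suc by simp
    have Z: "((\<lambda>q. prob_records q 1 s m) \<longlongrightarrow> perm_records s m) (at_left 1)"
      using less[of m s] Suc by simp
    have "((\<lambda>q. ((\<Sum>b\<le>m. real (Suc m choose b) * q ^ b * (1 - q) ^ (m - b) * prob_records q 0 s b)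
      + ?W q - prob_records q 1 s m) / (\<Sum>i\<le>m. q ^ i)) \<longlongrightarrow>
      ((\<Sum>b\<le>m. real (Suc m choose b) * 1 ^ b * (1 - 1) ^ (m - b) * perm_records s b)
      + ?w - perm_records s m) / (\<Sum>i\<le>m. 1 ^ i)) (at_left 1)"
      using less Suc by (intro tendsto_intros W Z) auto
    \<comment> \<open>Only \<open>b = m\<close> survives, where the power is
      \<open>0 ^ 0 = 1\<close>.\<close>
    also have "(\<Sum>b\<le>m. real (Suc m choose b) * 1 ^ b * (1 - 1) ^ (m - b) * perm_records s b) =
      (\<Sum>b\<le>m. if b = m then real (Suc m) * perm_records s m else 0)"
      by (intro sum.cong) auto
    also have "\<dots> = real (Suc m) * perm_records s m"
      by simp
    also have "(real (Suc m) * perm_records s m + ?w - perm_records s m) / (\<Sum>i\<le>m. 1 ^ i) = perm_records s n"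
      by (simp add: Suc algebra_simps)
    finally have "((\<lambda>q. prob_records q 0 s n) \<longlongrightarrow> perm_records s n) (at_left 1)"
      by (rule Lim_transform_eventually)
        (use eventually_at_left_1 in \<open>auto elim!: eventually_mono simp: prob_records_recursion Suc\<close>)
    moreover from this have "((\<lambda>q. prob_records q 0 s n - (1 - q) * (?W q - prob_records q 1 s m)) \<longlongrightarrow>
      perm_records s n - (1 - 1) * (?w - perm_records s m)) (at_left 1)"
      by (intro tendsto_intros W Z)
    then have "((\<lambda>q. prob_records q 0 s n - (1 - q) * (?W q - prob_records q 1 s m)) \<longlongrightarrow>
      perm_records s n) (at_left 1)"
      by simp
    then have "((\<lambda>q. prob_records q 1 s n) \<longlongrightarrow> perm_records s n) (at_left 1)"
    proof (rule Lim_transform_eventually)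
      show "\<forall>\<^sub>F q in at_left 1. prob_records q 0 s n - (1 - q) * (?W q - prob_records q 1 s m) = prob_records q 1 s n"
        using eventually_at_left_1
      proof eventually_elim
        case (elim q)
        then show ?case
          using prob_records_diff_Suc[of q 0 s m] Suc by (cases "s = 0") auto
      qed
    qed
    ultimately show ?thesis ..
  qed
qed

text \<open>The initial letter 1 contributes the factor \<open>1 - q\<close>, asymptotic to
  \<open>ln (1 / q)\<close>; the rest converges by Tannery's theorem and is summed by
  \<open>perm_records_sums\<close>.\<close>

lemma mean_constant_tendsto:
  assumes r: "1 \<le> r"
  shows "((\<lambda>q. (\<Sum>b. low_start q r (Suc b) / (real (Suc b) * real (Suc (Suc b)))) / ln (1 / q))
    \<longlongrightarrow> (1 / 2) ^ r) (at_left 1)"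
proof -
  obtain s where s: "r = Suc s" using r by (cases r) auto
  let ?x = "\<lambda>b. real (Suc b) * real (Suc (Suc b))"
  have "((\<lambda>q. \<Sum>b. prob_records q 1 s b / ?x b) \<longlongrightarrow> (\<Sum>b. perm_records s b / ?x b)) (at_left 1)"
  proof (rule tendsto_suminf_dominated[where M = "\<lambda>b. 1 / ?x b"])
    show "((\<lambda>q. prob_records q 1 s b / ?x b) \<longlongrightarrow> perm_records s b / ?x b) (at_left 1)" for b
      using prob_records_tendsto[of s b] by (intro tendsto_intros) auto
    show "\<forall>\<^sub>F q in at_left 1. \<forall>b. \<bar>prob_records q 1 s b / ?x b\<bar> \<le> 1 / ?x b"
      using eventually_at_left_1
    proof eventually_elim
      case (elim q)
      then have "\<bar>prob_records q 1 s b / ?x b\<bar> = prob_records q 1 s b / ?x b" for b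
        using prob_records_bounds[of q] by simp
      then show ?case
        using elim prob_records_bounds[of q] by (auto intro!: divide_right_mono)
    qed
    show "summable (\<lambda>b. 1 / ?x b)"
      by (rule sums_summable[OF inverse_consecutive_sums])
  qed simp
  moreover have "((\<lambda>q::real. (1 - q) / ln (1 / q)) \<longlongrightarrow> 1) (at_left 1)"
    by real_asymp
  ultimately have "((\<lambda>q. (1 - q) / ln (1 / q) * (\<Sum>b. prob_records q 1 s b / ?x b)) \<longlongrightarrow>
    1 * (\<Sum>b. perm_records s b / ?x b)) (at_left 1)"
    by (rule tendsto_mult[rotated])
  moreover have "(\<Sum>b. perm_records s b / ?x b) = (1 / 2) ^ r"
    unfolding s using perm_records_sums by (rule sums_unique[symmetric])
  moreover have "\<forall>\<^sub>F q in at_left 1. (1 - q) / ln (1 / q) * (\<Sum>b. prob_records q 1 s b / ?x b) =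
    (\<Sum>b. low_start q r (Suc b) / ?x b) / ln (1 / q)"
    using eventually_at_left_1
  proof eventually_elim
    case (elim q)
    have "summable (\<lambda>b. prob_records q 1 s b / ?x b)"
      by (rule summable_comparison_test[OF _ sums_summable[OF inverse_consecutive_sums]])
        (use elim prob_records_bounds[of q] in \<open>auto intro!: divide_right_mono\<close>)
    from suminf_mult[OF this, of "1 - q"] show ?case
      by (simp add: low_start_def s)
  qed
  ultimately show ?thesis by (auto intro: Lim_transform_eventually)
qed

section \<open>Random permutations\<close>

lemma ltr_max_snoc:
  "ltr_max (w @ [c]) = (if \<forall>x\<in>set w. x < c then insert (length w) (ltr_max w) else ltr_max w)"
proof -
  have "i \<in> ltr_max (w @ [c]) \<longleftrightarrow> i \<in> ltr_max w \<or> (i = length w \<and> (\<forall>x\<in>set w. x < c))" for i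
  proof (cases "i < length w")
    case True
    then show ?thesis by (auto simp: ltr_max_def nth_append)
  next
    case False
    then show ?thesis
      by (auto simp: ltr_max_def nth_append all_set_conv_all_nth less_Suc_eq)
  qed
  then show ?thesis by auto
qed

lemma finite_ltr_max [simp]: "finite (ltr_max w)"
  by (rule finite_subset[of _ "{..<length w}"]) (auto simp: ltr_max_def)

lemma sorted_list_of_ltr_max_snoc:
  "sorted_list_of_set (ltr_max (w @ [c])) =
    sorted_list_of_set (ltr_max w) @ (if \<forall>x\<in>set w. x < c then [length w] else [])"
proof (cases "\<forall>x\<in>set w. x < c")
  case True
  have lt: "\<forall>i\<in>ltr_max w. i < length w"
    by (simp add: ltr_max_def)
  have "sorted_list_of_set (ltr_max (w @ [c])) = sorted_list_of_set (ltr_max w) @ [length w]"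
  proof (rule sorted_distinct_set_unique)
    show "set (sorted_list_of_set (ltr_max (w @ [c]))) = set (sorted_list_of_set (ltr_max w) @ [length w])"
      unfolding set_sorted_list_of_set[OF finite_ltr_max] using True by (simp add: ltr_max_snoc)
  qed (use lt in \<open>auto simp: sorted_append intro: less_imp_le\<close>)
  with True show ?thesis by simp
next
  case False
  have "ltr_max (w @ [c]) = ltr_max w"
    unfolding ltr_max_snoc using False by (rule if_not_P)
  then show ?thesis
    unfolding if_not_P[OF False] by simp
qed

text \<open>The value at \<open>r = 0\<close> is the one that makes \<open>rth_position_snoc\<close> hold for \<open>r = 0\<close>.\<close>
definition rth_position :: "nat \<Rightarrow> nat list \<Rightarrow> real" where
  "rth_position r w = (if r = 0 then real (length w + 1)
     else if r \<le> card (ltr_max w) then real (rth_ltr_max_idx r w + 1) else 0)"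

lemma card_ltr_max: "card (ltr_max w) = length (sorted_list_of_set (ltr_max w))"
  by simp

text \<open>A new last maximum is the first from the right and raises the rank of all earlier ones
  by one.\<close>

lemma rth_position_snoc:
  "rth_position (Suc r) (w @ [c]) = (if \<forall>x\<in>set w. x < c then rth_position r w else rth_position (Suc r) w)"
proof -
  define l where "l = sorted_list_of_set (ltr_max w)"
  have pos: "rth_position r w = (if r = 0 then real (length w + 1)
     else if r \<le> length l then real (rev l ! (r - 1) + 1) else 0)" for r
    unfolding rth_position_def rth_ltr_max_idx_def card_ltr_max l_def ..
  show ?thesis
  proof (cases "\<forall>x\<in>set w. x < c")
    case True
    then have "sorted_list_of_set (ltr_max (w @ [c])) = l @ [length w]"
      by (simp add: sorted_list_of_ltr_max_snoc l_def)
    then have "rth_position (Suc r) (w @ [c]) =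
      (if Suc r \<le> Suc (length l) then real ((length w # rev l) ! r + 1) else 0)"
      unfolding rth_position_def rth_ltr_max_idx_def card_ltr_max by simp
    also have "\<dots> = rth_position r w"
      unfolding pos by (cases r) auto
    finally show ?thesis using True by simp
  next
    case False
    then have "ltr_max (w @ [c]) = ltr_max w"
      unfolding ltr_max_snoc by (rule if_not_P)
    then show ?thesis
      using False by (auto simp: rth_position_def rth_ltr_max_idx_def)
  qed
qed

lemma permutations_of_set_snoc:
  assumes "A \<noteq> {}"
  shows "permutations_of_set A = (\<Union>c\<in>A. (\<lambda>w. w @ [c]) ` permutations_of_set (A - {c}))"
proof -
  have "permutations_of_set A = rev ` permutations_of_set A"
    by simp
  also have "\<dots> = (\<Union>c\<in>A. (\<lambda>w. rev w @ [c]) ` permutations_of_set (A - {c}))"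
    by (subst permutations_of_set_nonempty[OF assms]) (simp add: image_UN image_image)
  also have "\<dots> = (\<Union>c\<in>A. (\<lambda>w. w @ [c]) ` (rev ` permutations_of_set (A - {c})))"
    unfolding image_image ..
  finally show ?thesis by simp
qed

lemma sum_permutations_of_set_snoc:
  fixes f :: "'a list \<Rightarrow> real"
  assumes "finite A" "A \<noteq> {}"
  shows "(\<Sum>w\<in>permutations_of_set A. f w) = (\<Sum>c\<in>A. \<Sum>w\<in>permutations_of_set (A - {c}). f (w @ [c]))"
proof -
  have "(\<Sum>w\<in>permutations_of_set A. f w) =
    (\<Sum>c\<in>A. \<Sum>w\<in>(\<lambda>w. w @ [c]) ` permutations_of_set (A - {c}). f w)"
    unfolding permutations_of_set_snoc[OF assms(2)]
    using assms(1) by (intro sum.UNION_disjoint) auto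
  also have "\<dots> = (\<Sum>c\<in>A. \<Sum>w\<in>permutations_of_set (A - {c}). f (w @ [c]))"
    by (intro sum.cong refl sum.reindex_cong[where l = "\<lambda>w. w @ [_]"]) (auto simp: inj_on_def)
  finally show ?thesis .
qed

section \<open>The recursion for the mean position and its solution\<close>

text \<open>The last of \<open>n + 1\<close> entries is the largest with probability
  \<open>1 / (n + 1)\<close>, and then the rank sought among the others drops by one.\<close>

fun mean_position :: "nat \<Rightarrow> nat \<Rightarrow> real" where
  "mean_position 0 n = real n + 1"
| "mean_position (Suc r) 0 = 0"
| "mean_position (Suc r) (Suc n) = (real n * mean_position (Suc r) n + mean_position r n) / real (Suc n)"

text \<open>Stated for arbitrary finite sets, because deleting the last entry of a permutation of an
  interval need not leave an interval. The last entry is a maximum exactly when it is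
  \<open>Max A\<close>.\<close>

lemma sum_rth_position:
  assumes "finite A"
  shows "(\<Sum>w\<in>permutations_of_set A. rth_position r w) = fact (card A) * mean_position r (card A)"
  using assms
proof (induction "card A" arbitrary: A r)
  case 0
  then have "A = {}" by simp
  then show ?case by (cases r) (auto simp: rth_position_def ltr_max_def)
next
  case (Suc n)
  then have A: "A \<noteq> {}" by auto
  show ?case
  proof (cases r)
    case 0
    have "(\<Sum>w\<in>permutations_of_set A. rth_position r w) = (\<Sum>w\<in>permutations_of_set A. real (card A) + 1)"
      using 0 by (intro sum.cong) (auto simp: rth_position_def length_finite_permutations_of_set)
    then show ?thesis using Suc.prems 0 by simp
  next
    case (Suc s)
    define M where "M = Max A"
    have M: "M \<in> A" using A Suc.prems by (simp add: M_def)
    have card: "card (A - {c}) = n" if "c \<in> A" for c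
      using that Suc.hyps(2) Suc.prems by (simp add: card_Diff_singleton)
    have rec: "(\<forall>x\<in>set w. x < c) \<longleftrightarrow> c = M" if "c \<in> A" "w \<in> permutations_of_set (A - {c})" for c w
    proof -
      have *: "set w = A - {c}" using that by (simp add: permutations_of_set_def)
      show ?thesis
      proof
        assume "\<forall>x\<in>set w. x < c"
        then show "c = M"
          using * M that(1) Suc.prems A by (metis DiffI M_def Max_ge linorder_not_less singletonD)
      next
        assume "c = M"
        then show "\<forall>x\<in>set w. x < c"
          using * Suc.prems by (auto simp: M_def le_neq_implies_less)
      qed
    qed
    have "(\<Sum>w\<in>permutations_of_set A. rth_position r w) =
      (\<Sum>c\<in>A. \<Sum>w\<in>permutations_of_set (A - {c}). rth_position (if c = M then s else r) w)"
      unfolding sum_permutations_of_set_snoc[OF Suc.prems A]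
      by (intro sum.cong refl) (use rec in \<open>auto simp: \<open>r = Suc s\<close> rth_position_snoc\<close>)
    also have "\<dots> = (\<Sum>c\<in>A. fact n * mean_position (if c = M then s else r) n)"
      using Suc.hyps(1)[of "A - {_}"] Suc.prems card by (intro sum.cong refl) simp
    also have "\<dots> = fact n * mean_position s n + (\<Sum>c\<in>A - {M}. fact n * mean_position r n)"
      by (subst sum.remove[OF Suc.prems M]) simp
    also have "\<dots> = fact n * (real n * mean_position r n + mean_position s n)"
      using card[OF M] by (simp add: algebra_simps)
    also have "\<dots> = fact (card A) * mean_position r (card A)"
      unfolding Suc.hyps(2)[symmetric] \<open>r = Suc s\<close> by (simp add: field_simps)
    finally show ?thesis .
  qed
qed

lemma E_perm_eq_mean_position:
  assumes "1 \<le> r"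
  shows "E_perm r n = mean_position r n"
proof -
  have "E_perm r n = (\<Sum>w\<in>permutations_of_set {1..n}. rth_position r w) / fact n"
    unfolding E_perm_def using assms
    by (intro arg_cong2[where f = "(/)"] sum.cong refl) (auto simp: rth_position_def)
  then show ?thesis by (simp add: sum_rth_position)
qed

text \<open>An induction on \<open>r\<close> and, inside it, on \<open>n\<close>:
  \<open>n / 2 ^ r\<close> solves the recursion up to a bounded term.\<close>

lemma mean_position_error: "\<bar>mean_position r n - real n / 2 ^ r\<bar> \<le> real r + 1"
proof (induction r arbitrary: n)
  case (Suc r)
  note IH = Suc.IH
  show ?case
  proof (induction n)
    case (Suc n)
    define a where "a = 1 / (2::real) ^ Suc r"
    have a: "0 < a" "a \<le> 1" using one_le_power[of "2::real" "Suc r"] by (auto simp: a_def)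
    have 1: "\<bar>mean_position r n - 2 * real n * a\<bar> \<le> real r + 1"
      using IH[of n] by (simp add: a_def)
    have 2: "\<bar>real n * (mean_position (Suc r) n - real n * a)\<bar> \<le> real n * (real r + 2)"
      unfolding abs_mult using Suc.IH by (auto simp: a_def intro!: mult_left_mono)
    \<comment> \<open>This rests on \<open>n ^ 2 + 2 * n = (n + 1) ^ 2 - 1\<close>; the defect is
      the single term \<open>a\<close>, at most 1.\<close>
    have *: "(mean_position (Suc r) (Suc n) - real (Suc n) * a) * real (Suc n) =
      real n * (mean_position (Suc r) n - real n * a) + (mean_position r n - 2 * real n * a) - a"
      by (simp add: field_simps)
    have "\<bar>mean_position (Suc r) (Suc n) - real (Suc n) * a\<bar> * real (Suc n) \<le> (real r + 2) * real (Suc n)"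
    proof -
      have "\<bar>(mean_position (Suc r) (Suc n) - real (Suc n) * a) * real (Suc n)\<bar> \<le>
        real n * (real r + 2) + (real r + 1) + 1"
        unfolding * using 1 2 a by linarith
      then show ?thesis
        unfolding abs_mult by (simp add: algebra_simps del: mean_position.simps)
    qed
    then have "\<bar>mean_position (Suc r) (Suc n) - real (Suc n) * a\<bar> \<le> real r + 2"
      by (rule mult_right_le_imp_le) simp
    then show ?case by (simp add: a_def del: mean_position.simps)
  qed simp
qed simp

lemma E_perm_asymptotics:
  assumes "1 \<le> r"
  shows "(\<lambda>n. E_perm r n - real n / 2 ^ r) \<in> o[at_top](\<lambda>n. real n)"
proof -
  have "(\<lambda>n. E_perm r n - real n / 2 ^ r) \<in> O(\<lambda>_. 1)"
    using mean_position_error[of r]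
    by (intro bigoI[of _ "real r + 1"]) (simp add: E_perm_eq_mean_position[OF assms])
  moreover have "(\<lambda>_. 1) \<in> o(\<lambda>n. real n)"
    by (intro smalloI_tendsto lim_1_over_n eventually_mono[OF eventually_gt_at_top[of 0]]) auto
  ultimately show ?thesis by (rule landau_o.big_small_trans)
qed

section \<open>Assembly of the geometric and permutation results\<close>

lemma record_weights_low_start:
  assumes "0 < q" "q < 1"
  shows "record_weights (low_start q r)"
  using low_start_bounds[OF assms] by unfold_locales (auto simp: low_start_def)

theorem mainTheorem9:
  fixes r :: nat
  assumes "r \<ge> 1"
  shows "\<exists>c :: real \<Rightarrow> real.
           (\<forall>q::real. 0 < q \<and> q < 1 \<longrightarrow>
              (\<exists>\<omega> :: real \<Rightarrow> real.
                 continuous_on UNIV \<omega> \<and> (\<forall>x. \<omega> (x + 1) = \<omega> x) \<and>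
                 integral {0..1} \<omega> = 0 \<and>
                 (\<lambda>n. E_geom r q n - c q * real n - real n * \<omega> (log (1 / q) (real n)))
                   \<in> o[at_top](\<lambda>n. real n)))
           \<and> (c \<longlongrightarrow> (1 / 2) ^ r) (at_left 1)
           \<and> (\<lambda>n. E_perm r n - real n / 2 ^ r) \<in> o[at_top](\<lambda>n. real n)"
proof (intro exI conjI allI impI)
  \<comment> \<open>This value is the mean of the periodised profile over one period, as computed by
    \<open>integral_periodised\<close>.\<close>
  define c where "c q = (\<Sum>b. low_start q r (Suc b) / (real (Suc b) * real (Suc (Suc b)))) / ln (1 / q)" for q
  show "(c \<longlongrightarrow> (1 / 2) ^ r) (at_left 1)"
    unfolding c_def using mean_constant_tendsto[OF assms] .
  show "(\<lambda>n. E_perm r n - real n / 2 ^ r) \<in> o(\<lambda>n. real n)"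
    by (rule E_perm_asymptotics[OF assms])
  fix q :: real assume "0 < q \<and> q < 1"
  then have q: "0 < q" "q < 1" and Q: "1 < 1 / q" by auto
  interpret record_weights "low_start q r"
    by (rule record_weights_low_start[OF q])
  let ?\<Phi> = "periodised (1 / q)"
  \<comment> \<open>Subtracting the mean leaves the oscillating part, which corresponds to the poles
    with \<open>k \<noteq> 0\<close>.\<close>
  define \<omega> where "\<omega> u = ?\<Phi> u - c q" for u
  have cont: "continuous_on A ?\<Phi>" for A
    using continuous_periodised[OF Q] by (rule continuous_on_subset) simp
  show "continuous_on UNIV \<omega>"
    unfolding \<omega>_def by (intro continuous_intros cont)
  show "\<omega> (x + 1) = \<omega> x" for x
    by (simp add: \<omega>_def periodised_periodic)
  have "integral {0..1} \<omega> = integral {0..1} ?\<Phi> - c q"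
    unfolding \<omega>_def by (subst integral_diff) (auto intro: integrable_continuous_real cont)
  also have "integral {0..1} ?\<Phi> = c q"
    unfolding integral_periodised[OF Q] c_def tail_coeff_def ..
  finally show "integral {0..1} \<omega> = 0" by simp
  let ?err = "\<lambda>n. E_geom r q n - c q * real n - real n * \<omega> (log (1 / q) (real n))"
  have "(\<lambda>n. ?err n / real n) \<longlonglongrightarrow> 0"
  proof (rule Lim_transform_eventually)
    show "(\<lambda>n. E_geom r q n / real n - ?\<Phi> (log (1 / q) (real n))) \<longlonglongrightarrow> 0"
      by (rule periodised_asymptotics[OF q E_geom_sums[OF q assms]])
    show "\<forall>\<^sub>F n in sequentially. E_geom r q n / real n - ?\<Phi> (log (1 / q) (real n)) = ?err n / real n"
      using eventually_gt_at_top[of 0] by eventually_elim (simp add: \<omega>_def field_simps)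
  qed
  then show "?err \<in> o(\<lambda>n. real n)"
    by (rule smalloI_tendsto) (auto intro: eventually_mono[OF eventually_gt_at_top[of 0]])
qed

end
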